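(* Let $\mathcal{O}\in\{\mathrm{MIO},\mathrm{DIO},\mathrm{IO},\mathrm{SIO}\}$ and let $\rho$ be a density matrix on $\mathcal{H}_d$. For any integer $m\ge1$ it holds that $$F_{A,\mathcal{O}}(\rho,m)\le\frac1m\,\|\delta(\rho)\|_{[m]}^2,$$ with equality if $d\le3$, or if $\rho=\sigma^{\otimes n}$ for some $n\in\mathbb{N}$ and a state $\sigma$ of dimension at most $3$.
   Context: $\mathcal{H}_d$ is a complex Hilbert space of finite dimension $d$ with a fixed orthonormal (reference) basis $\{|i\rangle\}_{i=1}^d$; for tensor powers the reference basis is the product basis. For a unit vector $|\psi\rangle$, $\psi:=|\psi\rangle\langle\psi|$. $\langle X,Y\rangle=\mathrm{Tr}(X^\dagger Y)$. $\||x\rangle\|_{\ell_p}$ is the $\ell_p$ norm of the coefficients of $|x\rangle$ in the reference basis. $\Delta$ denotes the dephasing map $\Delta(X)=\sum_i|i\rangle\langle i|X|i\rangle\langle i|$ in the reference basis of the relevant space; a state $\omega$ is incoherent if $\omega=\Delta(\omega)$. $\delta(\rho)$ denotes the $d$-dimensional vector whose entries are the square roots of the diagonal elements of $\rho$, i.e. $\delta(\rho)_i=\sqrt{\langle i|\rho|i\rangle}$. The $m$-distillation norm of a vector $|\psi\rangle\in\mathcal{H}_d$ is $$\||\psi\rangle\|_{[m]}:=\min_{|x\rangle\in\mathcal{H}_d}\ \||\psi\rangle-|x\rangle\|_{\ell_1}+\sqrt m\,\||x\rangle\|_{\ell_2}.$$ Free operations (quantum channels from operators on $\mathcal{H}_d$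 to operators on an $m$-dimensional space with its own reference basis $\{|i\rangle\}_{i=1}^m$): MIO are channels mapping every incoherent state to an incoherent state; DIO are channels $\mathscr{E}$ with $\Delta[\mathscr{E}(X)]=\mathscr{E}[\Delta(X)]$ for all $X$; IO are channels having a Kraus decomposition $\{K_\ell\}$ with every $K_\ell$ incoherent, i.e. $K_\ell\sigma K_\ell^\dagger$ is diagonal for every incoherent $\sigma$; SIO are channels having a Kraus decomposition $\{K_\ell\}$ in which all $K_\ell$ and all $K_\ell^\dagger$ are incoherent in this sense. $|\Psi_m\rangle=\sum_{i=1}^m\frac1{\sqrt m}|i\rangle$. The fidelity of assisted distillation is $$F_{A,\mathcal{O}}(\rho,m):=\max\Big\{\Big\langle\sum_ip_i\Lambda_i(\psi_i),\Psi_m\Big\rangle : \rho=\sum_ip_i\psi_i,\ \Lambda_i\in\mathcal{O}\ \forall i\Big\},$$ where the maximum is over all (finite) pure-state convex decompositions of $\rho$ and all choices of $\Lambda_i$. *)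

theory Defs
  imports Complex_Main "Jordan_Normal_Form.Schur_Decomposition"
begin

text \<open>
  The space of dimension \<open>d\<close> is \<open>carrier_vec d\<close>, its reference basis the unit vectors (indexed
  from \<open>0\<close>), and its operators are \<open>carrier_mat d d\<close>. A linear map between operator spaces is a
  function on \<^typ>\<open>complex mat\<close> of which only the values on \<open>carrier_mat d d\<close> matter.
\<close>

definition mat_sum :: "nat \<Rightarrow> nat \<Rightarrow> ('i \<Rightarrow> complex mat) \<Rightarrow> 'i set \<Rightarrow> complex mat" where
  "mat_sum r c A I = mat r c (\<lambda>ij. \<Sum>k\<in>I. A k $$ ij)"

definition mtrace :: "complex mat \<Rightarrow> complex" where
  "mtrace A = (\<Sum>i<dim_row A. A $$ (i, i))"

definition hs_inner :: "complex mat \<Rightarrow> complex mat \<Rightarrow> complex" where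
  "hs_inner X Y = mtrace (mat_adjoint X * Y)"

definition psd :: "nat \<Rightarrow> complex mat \<Rightarrow> bool" where
  "psd d A \<longleftrightarrow> A \<in> carrier_mat d d \<and> (\<forall>v\<in>carrier_vec d. 0 \<le> (A *\<^sub>v v) \<bullet>c v)"

definition density_op :: "nat \<Rightarrow> complex mat \<Rightarrow> bool" where
  "density_op d \<rho> \<longleftrightarrow> psd d \<rho> \<and> mtrace \<rho> = 1"

definition unit_ket :: "nat \<Rightarrow> complex vec \<Rightarrow> bool" where
  "unit_ket d v \<longleftrightarrow> v \<in> carrier_vec d \<and> v \<bullet>c v = 1"

definition proj :: "complex vec \<Rightarrow> complex mat" where
  "proj v = mat (dim_vec v) (dim_vec v) (\<lambda>(i, j). v $ i * cnj (v $ j))"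

definition kron :: "complex mat \<Rightarrow> complex mat \<Rightarrow> complex mat" where
  "kron A B = mat (dim_row A * dim_row B) (dim_col A * dim_col B)
     (\<lambda>(i, j). A $$ (i div dim_row B, j div dim_col B) * B $$ (i mod dim_row B, j mod dim_col B))"

fun tensor_power :: "complex mat \<Rightarrow> nat \<Rightarrow> complex mat" where
  "tensor_power \<sigma> 0 = 1\<^sub>m 1"
| "tensor_power \<sigma> (Suc n) = kron \<sigma> (tensor_power \<sigma> n)"

definition dephase :: "complex mat \<Rightarrow> complex mat" where
  "dephase X = mat (dim_row X) (dim_col X) (\<lambda>(i, j). if i = j then X $$ (i, j) else 0)"

definition incoherent_state :: "nat \<Rightarrow> complex mat \<Rightarrow> bool" where
  "incoherent_state d \<sigma> \<longleftrightarrow> density_op d \<sigma> \<and> \<sigma> = dephase \<sigma>"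

definition linear_map :: "nat \<Rightarrow> nat \<Rightarrow> (complex mat \<Rightarrow> complex mat) \<Rightarrow> bool" where
  "linear_map d m \<E> \<longleftrightarrow>
     (\<forall>X\<in>carrier_mat d d. \<E> X \<in> carrier_mat m m) \<and>
     (\<forall>X\<in>carrier_mat d d. \<forall>Y\<in>carrier_mat d d. \<E> (X + Y) = \<E> X + \<E> Y) \<and>
     (\<forall>c. \<forall>X\<in>carrier_mat d d. \<E> (c \<cdot>\<^sub>m X) = c \<cdot>\<^sub>m \<E> X)"

text \<open>
  The map \<open>id\<^sub>k \<otimes> \<E>\<close>: with the index convention of \<^const>\<open>kron\<close>, an operator on the composite
  space is a \<open>k \<times> k\<close> array of \<open>d \<times> d\<close> blocks, and \<open>\<E>\<close> is applied to each block.
\<close>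

definition ampliation ::
    "nat \<Rightarrow> nat \<Rightarrow> nat \<Rightarrow> (complex mat \<Rightarrow> complex mat) \<Rightarrow> complex mat \<Rightarrow> complex mat" where
  "ampliation k d m \<E> X = mat (k * m) (k * m) (\<lambda>(r, c).
     \<E> (mat d d (\<lambda>(i, j). X $$ (r div m * d + i, c div m * d + j))) $$ (r mod m, c mod m))"

definition completely_positive :: "nat \<Rightarrow> nat \<Rightarrow> (complex mat \<Rightarrow> complex mat) \<Rightarrow> bool" where
  "completely_positive d m \<E> \<longleftrightarrow> (\<forall>k X. psd (k * d) X \<longrightarrow> psd (k * m) (ampliation k d m \<E> X))"

definition channel :: "nat \<Rightarrow> nat \<Rightarrow> (complex mat \<Rightarrow> complex mat) \<Rightarrow> bool" where
  "channel d m \<E> \<longleftrightarrow> linear_map d m \<E> \<and> completely_positive d m \<E> \<and>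
     (\<forall>X\<in>carrier_mat d d. mtrace (\<E> X) = mtrace X)"

definition kraus_decomposition ::
    "nat \<Rightarrow> nat \<Rightarrow> (complex mat \<Rightarrow> complex mat) \<Rightarrow> nat \<Rightarrow> (nat \<Rightarrow> complex mat) \<Rightarrow> bool" where
  "kraus_decomposition d m \<E> N K \<longleftrightarrow>
     (\<forall>l<N. K l \<in> carrier_mat m d) \<and>
     (\<forall>X\<in>carrier_mat d d. \<E> X = mat_sum m m (\<lambda>l. K l * X * mat_adjoint (K l)) {..<N})"

definition incoherent_op :: "complex mat \<Rightarrow> bool" where
  "incoherent_op K \<longleftrightarrow>
     (\<forall>\<sigma>. incoherent_state (dim_col K) \<sigma> \<longrightarrow> diagonal_mat (K * \<sigma> * mat_adjoint K))"

type_synonym op_class = "nat \<Rightarrow> nat \<Rightarrow> (complex mat \<Rightarrow> complex mat) set"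

definition MIO :: op_class where
  "MIO d m = {\<E>. channel d m \<E> \<and> (\<forall>\<sigma>. incoherent_state d \<sigma> \<longrightarrow> incoherent_state m (\<E> \<sigma>))}"

definition DIO :: op_class where
  "DIO d m = {\<E>. channel d m \<E> \<and> (\<forall>X\<in>carrier_mat d d. dephase (\<E> X) = \<E> (dephase X))}"

definition IO :: op_class where
  "IO d m = {\<E>. channel d m \<E> \<and>
     (\<exists>N K. kraus_decomposition d m \<E> N K \<and> (\<forall>l<N. incoherent_op (K l)))}"

definition SIO :: op_class where
  "SIO d m = {\<E>. channel d m \<E> \<and>
     (\<exists>N K. kraus_decomposition d m \<E> N K \<and>
        (\<forall>l<N. incoherent_op (K l) \<and> incoherent_op (mat_adjoint (K l))))}"

definition l1_norm :: "complex vec \<Rightarrow> real" where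
  "l1_norm v = (\<Sum>i<dim_vec v. cmod (v $ i))"

definition l2_norm :: "complex vec \<Rightarrow> real" where
  "l2_norm v = sqrt (\<Sum>i<dim_vec v. (cmod (v $ i))\<^sup>2)"

definition distillation_norm :: "nat \<Rightarrow> complex vec \<Rightarrow> real" where
  "distillation_norm m v =
     (INF x\<in>carrier_vec (dim_vec v). l1_norm (v - x) + sqrt (real m) * l2_norm x)"

definition sqrt_diag :: "complex mat \<Rightarrow> complex vec" where
  "sqrt_diag \<rho> = vec (dim_row \<rho>) (\<lambda>i. complex_of_real (sqrt (Re (\<rho> $$ (i, i)))))"

definition max_coherent :: "nat \<Rightarrow> complex vec" where
  "max_coherent m = vec m (\<lambda>_. complex_of_real (1 / sqrt (real m)))"

definition pure_decomposition ::
    "nat \<Rightarrow> complex mat \<Rightarrow> nat \<Rightarrow> (nat \<Rightarrow> real) \<Rightarrow> (nat \<Rightarrow> complex vec) \<Rightarrow> bool" where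
  "pure_decomposition d \<rho> N p \<psi> \<longleftrightarrow>
     (\<forall>i<N. 0 \<le> p i \<and> unit_ket d (\<psi> i)) \<and> (\<Sum>i<N. p i) = 1 \<and>
     \<rho> = mat_sum d d (\<lambda>i. complex_of_real (p i) \<cdot>\<^sub>m proj (\<psi> i)) {..<N}"

text \<open>
  The values over which assisted distillation is optimised. The Hilbert-Schmidt product below is
  one of two Hermitian matrices, hence real, so that \<^const>\<open>Re\<close> is only a change of type.
\<close>

definition assisted_fidelities :: "op_class \<Rightarrow> nat \<Rightarrow> nat \<Rightarrow> complex mat \<Rightarrow> real set" where
  "assisted_fidelities \<O> d m \<rho> =
     {Re (hs_inner (mat_sum m m (\<lambda>i. complex_of_real (p i) \<cdot>\<^sub>m \<Lambda> i (proj (\<psi> i))) {..<N})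
                   (proj (max_coherent m))) | N p \<psi> \<Lambda>.
        pure_decomposition d \<rho> N p \<psi> \<and> (\<forall>i<N. \<Lambda> i \<in> \<O> d m)}"

definition assisted_fidelity :: "op_class \<Rightarrow> nat \<Rightarrow> nat \<Rightarrow> complex mat \<Rightarrow> real" where
  "assisted_fidelity \<O> d m \<rho> = Sup (assisted_fidelities \<O> d m \<rho>)"

end

theory Submission
  imports Defs "HOL-Analysis.L2_Norm"
begin

text \<open>
  Upper bound: for an MIO channel \<open>\<Lambda>\<close> the form \<open>u \<mapsto> m \<langle>\<Lambda>(|u\<rangle>\<langle>u|), \<Psi>\<^sub>m\<rangle>\<close> is positive, is dominated by
  \<open>m \<parallel>u\<parallel>\<^sup>2\<close> and equals \<open>1\<close> on the reference basis. The root of the \<open>p\<close>-average of these forms is a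
  seminorm on families \<open>(\<psi>\<^sub>k)\<close>; splitting \<open>\<psi>\<^sub>k\<close> entrywise into the fractions \<open>1 - x\<^sub>i/\<delta>\<^sub>i\<close> and
  \<open>x\<^sub>i/\<delta>\<^sub>i\<close> bounds it by \<open>\<parallel>\<delta> - x\<parallel>\<^sub>1 + \<surd>m \<parallel>x\<parallel>\<^sub>2\<close> for every \<open>x\<close>.

  Attainment for a pure state with moduli \<open>a\<close>: choose the level \<open>t\<close> such that \<open>r\<^sub>i = min (a\<^sub>i\<^sup>2/t\<^sup>2) 1\<close>
  sums to \<open>m\<close>, write \<open>r\<close> as a mixture \<open>q\<close> of indicators of \<open>m\<close>-subsets, and use one Kraus operator
  per subset \<open>S\<close>, which relabels \<open>S\<close> injectively with weights \<open>\<surd>(q\<^sub>S/r\<^sub>i)\<close>. Every subset then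
  contributes in proportion to the same amplitude, the distillation norm with \<open>x\<^sub>i = min a\<^sub>i t\<close>.

  For \<open>d \<le> 3\<close>, \<open>\<rho>\<close> is a mixture of pure states which all have the moduli \<open>\<delta>(\<rho>)\<close>: two unnormalised
  vectors can be rotated into each other so that two prescribed quadratic forms agree on the images,
  since a direction on the Bloch sphere orthogonal to two given ones exists. Such mixtures are
  closed under tensor products.
\<close>

section \<open>Positive semidefinite forms\<close>

lemma sum_swap3:
  "(\<Sum>i\<in>A. \<Sum>j\<in>B. \<Sum>k\<in>C. f i j k) = (\<Sum>k\<in>C. \<Sum>i\<in>A. \<Sum>j\<in>B. f i j k)"
  by (rule trans[OF sum.cong[OF refl sum.swap] sum.swap])

text \<open>An index of a composite space is a block number times the block length plus an offset;
  this is the convention of \<open>kron\<close> and \<open>ampliation\<close>.\<close>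

lemma sum_lessThan_mult:
  fixes h :: "nat \<Rightarrow> 'a :: comm_monoid_add"
  shows "(\<Sum>k<n * m. h k) = (\<Sum>b<n. \<Sum>a<m. h (b * m + a))"
proof -
  have "(\<Sum>k<n * m. h k) = (\<Sum>b<n. \<Sum>k\<in>{b * m..<b * m + m}. h k)"
    by (rule sum.nat_group[symmetric])
  also have "\<dots> = (\<Sum>b<n. \<Sum>a<m. h (b * m + a))"
  proof (rule sum.cong[OF refl])
    fix b
    show "(\<Sum>k\<in>{b * m..<b * m + m}. h k) = (\<Sum>a<m. h (b * m + a))"
      using sum.shift_bounds_nat_ivl[of h 0 "b * m" m] by (simp add: lessThan_atLeast0 add.commute)
  qed
  finally show ?thesis .
qed

text \<open>Matrices are functions of two indices here, so that an induction on \<open>d\<close> can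
  pass to the leading block without forming a submatrix.\<close>

definition qform :: "nat \<Rightarrow> (nat \<Rightarrow> nat \<Rightarrow> complex) \<Rightarrow> (nat \<Rightarrow> complex) \<Rightarrow> complex" where
  "qform d A u = (\<Sum>i<d. \<Sum>j<d. cnj (u i) * A i j * u j)"

definition psdf :: "nat \<Rightarrow> (nat \<Rightarrow> nat \<Rightarrow> complex) \<Rightarrow> bool" where
  "psdf d A \<longleftrightarrow> (\<forall>u. 0 \<le> qform d A u)"

lemma qform_Suc:
  "qform (Suc d) A u = qform d A u + cnj (u d) * (\<Sum>j<d. A d j * u j)
     + (\<Sum>i<d. cnj (u i) * A i d) * u d + cnj (u d) * A d d * u d"
  by (simp add: qform_def sum.distrib sum_distrib_left sum_distrib_right algebra_simps)

text \<open>Vectors supported on two indices are the test vectors for hermiticity, for a vanishing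
  diagonal entry and for the bound on entry sums.\<close>

lemma qform_two:
  assumes "i < d" "j < d" "i \<noteq> j"
  shows "qform d A ((\<lambda>_. 0)(i := s, j := t)) =
    cnj s * A i i * s + cnj s * A i j * t + cnj t * A j i * s + cnj t * A j j * t"
proof -
  have inner: "(\<Sum>l<d. cnj (((\<lambda>_. 0)(i := s, j := t)) k) * A k l * ((\<lambda>_. 0)(i := s, j := t)) l)
      = cnj (((\<lambda>_. 0)(i := s, j := t)) k) * (A k i * s + A k j * t)" for k
  proof -
    have "(\<Sum>l<d. cnj (((\<lambda>_. 0)(i := s, j := t)) k) * A k l * ((\<lambda>_. 0)(i := s, j := t)) l)
      = (\<Sum>l\<in>{i,j}. cnj (((\<lambda>_. 0)(i := s, j := t)) k) * A k l * ((\<lambda>_. 0)(i := s, j := t)) l)"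
      using assms by (intro sum.mono_neutral_right) auto
    then show ?thesis using assms by (simp add: algebra_simps)
  qed
  have "qform d A ((\<lambda>_. 0)(i := s, j := t)) =
     (\<Sum>k<d. cnj (((\<lambda>_. 0)(i := s, j := t)) k) * (A k i * s + A k j * t))"
    unfolding qform_def by (simp only: inner)
  also have "\<dots> = (\<Sum>k\<in>{i,j}. cnj (((\<lambda>_. 0)(i := s, j := t)) k) * (A k i * s + A k j * t))"
    using assms by (intro sum.mono_neutral_right) auto
  also have "\<dots> = cnj s * A i i * s + cnj s * A i j * t + cnj t * A j i * s + cnj t * A j j * t"
    using assms by (simp add: algebra_simps)
  finally show ?thesis .
qed

lemma psdf_diag:
  assumes "psdf d A" "i < d"
  shows "0 \<le> A i i"
proof -
  have "qform d A ((\<lambda>_. 0)(i := 1)) = (\<Sum>k<d. \<Sum>l<d. if l = i then if k = i then A k i else 0 else 0)"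
    unfolding qform_def by (intro sum.cong) auto
  also have "\<dots> = A i i" using assms(2) by simp
  finally show ?thesis using assms(1) by (metis psdf_def)
qed

text \<open>In the order on \<open>complex\<close>, a nonnegative number is real. Realness of the
  form at (1, 1) makes the imaginary parts of the two entries opposite, realness at (1,
  \<open>\<i>\<close>) makes their real parts equal.\<close>

lemma psdf_hermitian:
  assumes "psdf d A" "i < d" "j < d"
  shows "A j i = cnj (A i j)"
proof (cases "i = j")
  case True
  then show ?thesis using psdf_diag[OF assms(1,2)]
    by (simp add: less_eq_complex_def complex_eq_iff)
next
  case False
  have q: "0 \<le> cnj s * A i i * s + cnj s * A i j * t + cnj t * A j i * s + cnj t * A j j * t" for s t
    using assms(1) qform_two[OF assms(2,3) False, of A s t] unfolding psdf_def by metis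
  show ?thesis
    using q[of 1 1] q[of 1 \<i>] psdf_diag[OF assms(1,2)] psdf_diag[OF assms(1,3)]
    by (simp add: less_eq_complex_def complex_eq_iff)
qed

lemma psdf_zero_diag:
  assumes "psdf d A" "i < d" "j < d" "A j j = 0"
  shows "A i j = 0"
proof (cases "i = j")
  case False
  define z where "z = A i j"
  define a where "a = Re (A i i)"
  have a: "A i i = of_real a" "0 \<le> a"
    using psdf_diag[OF assms(1,2)] by (auto simp: less_eq_complex_def complex_eq_iff a_def)
  \<comment> \<open>With \<open>A j j = 0\<close> the form at (\<open>z\<close>, \<open>r\<close>)
    is \<open>a + 2 * r\<close> times the squared modulus of \<open>z\<close>; this choice of
    \<open>r\<close> makes the factor negative.\<close>
  define r where "r = - (a + 1)"
  have "0 \<le> qform d A ((\<lambda>_. 0)(i := z, j := of_real r))"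
    using assms(1) by (auto simp: psdf_def)
  also have "\<dots> = cnj z * a * z + cnj z * z * r + r * cnj z * z"
    using assms(4) psdf_hermitian[OF assms(1-3)] a by (simp add: qform_two[OF assms(2,3) False] z_def)
  also have "\<dots> = of_real (- (a + 2)) * (z * cnj z)"
    by (simp add: r_def algebra_simps)
  also have "\<dots> = of_real (- (a + 2) * (cmod z)\<^sup>2)"
    by (simp only: of_real_mult complex_norm_square)
  finally have "0 \<le> - (a + 2) * (cmod z)\<^sup>2"
    by (simp add: less_eq_complex_def)
  then have "(cmod z)\<^sup>2 \<le> 0"
    using a(2) by (smt (verit) mult_neg_pos)
  then show ?thesis by (simp add: z_def)
qed (use assms in simp)

text \<open>Induction on \<open>d\<close>, eliminating the last index: the Schur complement is again
  positive, and its vectors together with the scaled last column factorise \<open>A\<close>.\<close>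

lemma psdf_cholesky:
  assumes "psdf d A"
  shows "\<exists>v. \<forall>i<d. \<forall>j<d. A i j = (\<Sum>k<d. v k i * cnj (v k j))"
  using assms
proof (induction d arbitrary: A)
  case (Suc d)
  have herm: "A j i = cnj (A i j)" if "i < Suc d" "j < Suc d" for i j
    using psdf_hermitian[OF Suc.prems that] .
  define a where "a = Re (A d d)"
  have a: "A d d = of_real a" "0 \<le> a"
    using psdf_diag[OF Suc.prems, of d] by (auto simp: less_eq_complex_def complex_eq_iff a_def)
  \<comment> \<open>The Schur complement of the last diagonal entry. For \<open>a = 0\<close> the
    quotient is \<open>0\<close> by convention, which is right because the last row and column then
    vanish.\<close>
  define B where "B i j = A i j - A i d * A d j / a" for i j
  have "psdf d B"
    unfolding psdf_def
  proof
    fix u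
    define s where "s = (\<Sum>j<d. A d j * u j)"
    have cs: "(\<Sum>i<d. cnj (u i) * A i d) = cnj s"
      unfolding s_def using herm[of d] by (simp add: mult.commute)
    \<comment> \<open>The last coordinate completes the square: the form of \<open>A\<close> at
      \<open>w\<close> is the form of \<open>B\<close> at \<open>u\<close>.\<close>
    define w where "w = u(d := - s / a)"
    have w: "qform (Suc d) A w = qform d A u + cnj (w d) * s + cnj s * w d + cnj (w d) * A d d * w d"
    proof -
      have "qform d A w = qform d A u" "(\<Sum>j<d. A d j * w j) = s"
        "(\<Sum>i<d. cnj (w i) * A i d) = cnj s"
        unfolding qform_def s_def cs[unfolded s_def, symmetric] by (auto simp: w_def intro!: sum.cong)
      then show ?thesis by (simp add: qform_Suc)
    qed
    have "qform d B u = qform d A u - (\<Sum>i<d. \<Sum>j<d. (cnj (u i) * A i d) * (A d j * u j)) / a"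
      by (simp add: qform_def B_def algebra_simps sum_subtractf sum_divide_distrib)
    also have "\<dots> = qform d A u - cnj s * s / a"
      by (simp only: sum_product[symmetric] cs s_def[symmetric])
    also have "\<dots> = qform (Suc d) A w"
    proof (cases "a = 0")
      case True
      then show ?thesis using a by (simp add: w) (simp add: w_def)
    next
      case False
      then show ?thesis unfolding w a by (simp add: w_def field_simps)
    qed
    finally show "0 \<le> qform d B u" using Suc.prems by (auto simp: psdf_def)
  qed
  from Suc.IH[OF this] obtain v where
    v: "\<And>i j. i < d \<Longrightarrow> j < d \<Longrightarrow> B i j = (\<Sum>k<d. v k i * cnj (v k j))" by blast
  \<comment> \<open>The vectors of \<open>B\<close> are extended by \<open>0\<close>; the new one is
    the last column of \<open>A\<close> over the root of the pivot.\<close>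
  define v' where "v' k i = (if k < d then (if i < d then v k i else 0) else A i d / sqrt a)" for k i
  have sq: "of_real (sqrt a) * of_real (sqrt a) = (of_real a :: complex)"
    using a(2) by (metis of_real_mult real_sqrt_mult_self abs_of_nonneg)
  have "A i j = (\<Sum>k<Suc d. v' k i * cnj (v' k j))" if "i < Suc d" "j < Suc d" for i j
  proof -
    have last: "v' d i * cnj (v' d j) = A i d * A d j / a"
      using herm[of j d] that by (simp add: v'_def sq)
    show ?thesis
    proof (cases "i < d \<and> j < d")
      case True
      then have "(\<Sum>k<d. v' k i * cnj (v' k j)) = B i j"
        by (simp add: v v'_def)
      then show ?thesis by (simp only: sum.lessThan_Suc last) (simp add: B_def)
    next
      case False
      then have "(\<Sum>k<d. v' k i * cnj (v' k j)) = 0"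
        by (intro sum.neutral) (auto simp: v'_def)
      moreover have "A i j = A i d * A d j / a"
      proof (cases "a = 0")
        case True
        then show ?thesis
          using psdf_zero_diag[OF Suc.prems, of i d] herm[of j d] psdf_zero_diag[OF Suc.prems, of j d]
            False that a by (auto simp: less_Suc_eq)
      qed (use False that a in \<open>auto simp: less_Suc_eq\<close>)
      ultimately show ?thesis by (simp only: sum.lessThan_Suc last) simp
    qed
  qed
  then show ?case by blast
qed simp

section \<open>Seminorm estimates for forms with unit diagonal\<close>

lemma L2_set_sum_le:
  assumes "finite I"
  shows "L2_set (\<lambda>k. \<Sum>i\<in>I. f i k) A \<le> (\<Sum>i\<in>I. L2_set (f i) A)"
  using assms
proof (induction I)
  case (insert i I)
  then show ?case
    using L2_set_triangle_ineq[of "f i" "\<lambda>k. \<Sum>i\<in>I. f i k" A] by simp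
qed (simp add: L2_set_def)

text \<open>A factorisation of \<open>G\<close> exhibits the root of the form as the Euclidean norm
  of a linear image of \<open>u\<close>, hence as a seminorm. It is at most the l1 norm because
  basis vectors have value 1, and at most \<open>sqrt M\<close> times the l2 norm by
  \<open>bound\<close>. The first estimate is applied to \<open>u - y\<close>, the second to
  \<open>y\<close>.\<close>

lemma sqrt_qform_le:
  assumes G: "psdf d G" and diag: "\<And>i. i < d \<Longrightarrow> G i i = 1"
    and bound: "\<And>u. Re (qform d G u) \<le> M * (\<Sum>i<d. (cmod (u i))\<^sup>2)"
  shows "sqrt (Re (qform d G u)) \<le> (\<Sum>i<d. cmod (u i - y i)) + sqrt M * sqrt (\<Sum>i<d. (cmod (y i))\<^sup>2)"
proof -
  obtain v where v: "\<And>i j. i < d \<Longrightarrow> j < d \<Longrightarrow> G i j = (\<Sum>k<d. v k i * cnj (v k j))"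
    using psdf_cholesky[OF G] by blast
  define l where "l u k = (\<Sum>i<d. cnj (v k i) * u i)" for u :: "nat \<Rightarrow> complex" and k
  define N where "N u = L2_set (\<lambda>k. cmod (l u k)) {..<d}" for u
  have N: "N u = sqrt (Re (qform d G u))" for u
  proof -
    have "qform d G u = (\<Sum>i<d. \<Sum>j<d. \<Sum>k<d. cnj (u i) * v k i * (cnj (v k j) * u j))"
      unfolding qform_def by (intro sum.cong) (auto simp: v sum_distrib_left sum_distrib_right algebra_simps)
    also have "\<dots> = (\<Sum>k<d. \<Sum>i<d. \<Sum>j<d. cnj (u i) * v k i * (cnj (v k j) * u j))"
      by (subst sum.swap[of _ "{..<d}" "{..<d}"], subst (2) sum.swap) (rule refl)
    also have "\<dots> = (\<Sum>k<d. l u k * cnj (l u k))"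
      unfolding sum_product[symmetric] by (simp add: l_def mult.commute)
    also have "\<dots> = of_real (\<Sum>k<d. (cmod (l u k))\<^sup>2)"
      by (simp only: complex_norm_square of_real_sum)
    finally show ?thesis by (simp add: N_def L2_set_def)
  qed
  have tri: "N (\<lambda>i. a i + b i) \<le> N a + N b" for a b
  proof -
    have "N (\<lambda>i. a i + b i) \<le> L2_set (\<lambda>k. cmod (l a k) + cmod (l b k)) {..<d}"
      unfolding N_def
      by (intro L2_set_mono) (auto simp: l_def algebra_simps sum.distrib intro: norm_triangle_ineq)
    also have "\<dots> \<le> N a + N b"
      unfolding N_def by (rule L2_set_triangle_ineq)
    finally show ?thesis .
  qed
  have single: "N ((\<lambda>_. 0)(i := c)) = cmod c" if "i < d" for i c
  proof -
    have "qform d G ((\<lambda>_. 0)(i := c)) = (\<Sum>k<d. \<Sum>l<d. if l = i then if k = i then cnj c * G k i * c else 0 else 0)"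
      unfolding qform_def by (intro sum.cong) auto
    also have "\<dots> = c * cnj c" using that diag by (simp add: mult.commute)
    finally have "Re (qform d G ((\<lambda>_. 0)(i := c))) = (cmod c)\<^sup>2"
      by (metis complex_norm_square Re_complex_of_real)
    then show ?thesis by (simp add: N)
  qed
  \<comment> \<open>The l1 estimate, adding one coordinate at a time.\<close>
  have part: "N (\<lambda>i. if i < n then w i else 0) \<le> (\<Sum>i<n. cmod (w i))" if "n \<le> d" for n w
    using that
  proof (induction n)
    case 0
    then show ?case by (simp add: N_def l_def L2_set_def)
  next
    case (Suc n)
    have "(\<lambda>i. if i < Suc n then w i else 0) = (\<lambda>i. (if i < n then w i else 0) + ((\<lambda>_. 0)(n := w n)) i)"
      by (auto simp: fun_eq_iff less_Suc_eq)
    then show ?case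
      using tri[of "\<lambda>i. if i < n then w i else 0" "(\<lambda>_. 0)(n := w n)"] single[of n "w n"] Suc
      by simp
  qed
  have "N u = N (\<lambda>i. (u i - y i) + y i)" by simp
  also have "\<dots> \<le> N (\<lambda>i. u i - y i) + N y" by (rule tri)
  also have "N (\<lambda>i. u i - y i) = N (\<lambda>i. if i < d then u i - y i else 0)"
    by (simp add: N_def l_def)
  also have "\<dots> \<le> (\<Sum>i<d. cmod (u i - y i))" by (rule part) simp
  also have "N y \<le> sqrt M * sqrt (\<Sum>i<d. (cmod (y i))\<^sup>2)"
    using bound[of y] by (simp add: N real_sqrt_mult[symmetric])
  finally show ?thesis by (simp add: N)
qed

text \<open>The estimate for single forms is applied to every component with its own splitting,
  followed by Minkowski's inequality in the \<open>p\<close>-weighted l2 space over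
  \<open>k\<close>. The splitting fractions depend on \<open>i\<close> only, so averaging over
  \<open>k\<close> replaces the moduli of \<open>\<psi> k i\<close> by
  \<open>\<delta> i\<close>.\<close>

lemma sqrt_mixture_le:
  fixes \<delta> :: "nat \<Rightarrow> real" and x :: "nat \<Rightarrow> complex"
  assumes p: "\<And>k. k < N \<Longrightarrow> 0 \<le> p k"
    and G: "\<And>k. k < N \<Longrightarrow> psdf d (G k)" and diag: "\<And>k i. k < N \<Longrightarrow> i < d \<Longrightarrow> G k i i = 1"
    and bound: "\<And>k u. k < N \<Longrightarrow> Re (qform d (G k) u) \<le> M * (\<Sum>i<d. (cmod (u i))\<^sup>2)"
    and M: "0 \<le> M"
    and \<delta>: "\<And>i. i < d \<Longrightarrow> 0 \<le> \<delta> i" "\<And>i. i < d \<Longrightarrow> (\<delta> i)\<^sup>2 = (\<Sum>k<N. p k * (cmod (\<psi> k i))\<^sup>2)"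
  shows "sqrt (\<Sum>k<N. p k * Re (qform d (G k) (\<psi> k)))
     \<le> (\<Sum>i<d. cmod (\<delta> i - x i)) + sqrt M * sqrt (\<Sum>i<d. (cmod (x i))\<^sup>2)"
proof -
  \<comment> \<open>If \<open>\<delta> i = 0\<close>, every \<open>\<psi> k i\<close> with positive
    weight vanishes, and \<open>0\<close> is a harmless value.\<close>
  define y where "y k i = (if \<delta> i = 0 then 0 else \<psi> k i * (x i / \<delta> i))" for k i
  have pos: "0 \<le> Re (qform d (G k) (\<psi> k))" if "k < N" for k
    using G[OF that] by (simp add: psdf_def less_eq_complex_def)
  have "sqrt (\<Sum>k<N. p k * Re (qform d (G k) (\<psi> k)))
      = L2_set (\<lambda>k. sqrt (p k) * sqrt (Re (qform d (G k) (\<psi> k)))) {..<N}"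
    unfolding L2_set_def using p pos by (simp add: power_mult_distrib)
  also have "\<dots> \<le> L2_set (\<lambda>k. sqrt (p k) * ((\<Sum>i<d. cmod (\<psi> k i - y k i))
        + sqrt M * sqrt (\<Sum>i<d. (cmod (y k i))\<^sup>2))) {..<N}"
    using p pos G diag bound
    by (intro L2_set_mono mult_left_mono sqrt_qform_le) auto
  also have "\<dots> = L2_set (\<lambda>k. (\<Sum>i<d. sqrt (p k) * cmod (\<psi> k i - y k i))
        + sqrt M * (sqrt (p k) * sqrt (\<Sum>i<d. (cmod (y k i))\<^sup>2))) {..<N}"
    by (simp add: algebra_simps sum_distrib_left)
  also have "\<dots> \<le> L2_set (\<lambda>k. \<Sum>i<d. sqrt (p k) * cmod (\<psi> k i - y k i)) {..<N}
        + L2_set (\<lambda>k. sqrt M * (sqrt (p k) * sqrt (\<Sum>i<d. (cmod (y k i))\<^sup>2))) {..<N}"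
    by (rule L2_set_triangle_ineq)
  also have "L2_set (\<lambda>k. \<Sum>i<d. sqrt (p k) * cmod (\<psi> k i - y k i)) {..<N}
      \<le> (\<Sum>i<d. L2_set (\<lambda>k. sqrt (p k) * cmod (\<psi> k i - y k i)) {..<N})"
    by (rule L2_set_sum_le) simp
  also have "\<dots> \<le> (\<Sum>i<d. cmod (\<delta> i - x i))"
  proof (rule sum_mono)
    fix i assume "i \<in> {..<d}"
    then have i: "i < d" by simp
    \<comment> \<open>The modulus of the remaining fraction; being independent of \<open>k\<close>,
      it can be pulled out of the mean over \<open>k\<close>.\<close>
    define c where "c = (if \<delta> i = 0 then 1 else cmod (1 - x i / \<delta> i))"
    have "cmod (\<psi> k i - y k i) = cmod (\<psi> k i) * c" for k
    proof -
      have "\<psi> k i - y k i = \<psi> k i * (if \<delta> i = 0 then 1 else 1 - x i / \<delta> i)"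
        by (simp add: y_def right_diff_distrib)
      then show ?thesis by (simp add: norm_mult c_def)
    qed
    then have "L2_set (\<lambda>k. sqrt (p k) * cmod (\<psi> k i - y k i)) {..<N}
        = L2_set (\<lambda>k. sqrt (p k) * cmod (\<psi> k i)) {..<N} * c"
      by (subst L2_set_left_distrib) (auto simp: c_def mult.assoc)
    also have "L2_set (\<lambda>k. sqrt (p k) * cmod (\<psi> k i)) {..<N} = \<delta> i"
      unfolding L2_set_def using p \<delta>(1)[OF i] by (simp add: power_mult_distrib \<delta>(2)[OF i, symmetric])
    also have "\<delta> i * c \<le> cmod (\<delta> i - x i)"
    proof (cases "\<delta> i = 0")
      case False
      then have "of_real (\<delta> i) - x i = of_real (\<delta> i) * (1 - x i / \<delta> i)" by (simp add: field_simps)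
      then show ?thesis using \<delta>(1)[OF i] False by (simp add: c_def norm_mult)
    qed simp
    finally show "L2_set (\<lambda>k. sqrt (p k) * cmod (\<psi> k i - y k i)) {..<N} \<le> cmod (\<delta> i - x i)" .
  qed
  also have "L2_set (\<lambda>k. sqrt M * (sqrt (p k) * sqrt (\<Sum>i<d. (cmod (y k i))\<^sup>2))) {..<N}
      = sqrt M * L2_set (\<lambda>k. sqrt (p k) * sqrt (\<Sum>i<d. (cmod (y k i))\<^sup>2)) {..<N}"
    using M by (simp add: L2_set_right_distrib)
  also have "L2_set (\<lambda>k. sqrt (p k) * sqrt (\<Sum>i<d. (cmod (y k i))\<^sup>2)) {..<N}
      \<le> sqrt (\<Sum>i<d. (cmod (x i))\<^sup>2)"
  proof -
    have "(\<Sum>k<N. (sqrt (p k) * sqrt (\<Sum>i<d. (cmod (y k i))\<^sup>2))\<^sup>2)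
        = (\<Sum>k<N. \<Sum>i<d. p k * (cmod (y k i))\<^sup>2)"
      using p by (intro sum.cong) (auto simp: power_mult_distrib sum_nonneg sum_distrib_left)
    also have "\<dots> = (\<Sum>i<d. \<Sum>k<N. p k * (cmod (y k i))\<^sup>2)" by (rule sum.swap)
    also have "\<dots> \<le> (\<Sum>i<d. (cmod (x i))\<^sup>2)"
    proof (rule sum_mono)
      fix i assume "i \<in> {..<d}"
      then have i: "i < d" by simp
      show "(\<Sum>k<N. p k * (cmod (y k i))\<^sup>2) \<le> (cmod (x i))\<^sup>2"
      proof (cases "\<delta> i = 0")
        case False
        have "(\<Sum>k<N. p k * (cmod (y k i))\<^sup>2) = (\<Sum>k<N. p k * (cmod (\<psi> k i))\<^sup>2) * ((cmod (x i))\<^sup>2 / (\<delta> i)\<^sup>2)"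
          using False
          by (simp add: y_def norm_mult norm_divide power_mult_distrib power_divide sum_distrib_right sum_divide_distrib mult.assoc)
        also have "\<dots> = (cmod (x i))\<^sup>2" using False by (simp add: \<delta>(2)[OF i, symmetric])
        finally show ?thesis by simp
      qed (simp add: y_def)
    qed
    finally show ?thesis by (simp add: L2_set_def)
  qed
  finally show ?thesis using M by (simp add: mult_left_mono)
qed

section \<open>Decompositions with constant moduli\<close>

text \<open>The sign condition on \<open>z\<close> is free, since a vector may be replaced by its
  negative; it later keeps \<open>1 + z\<close> away from zero.\<close>

lemma ex_orthogonal_unit3:
  fixes a1 a2 a3 b1 b2 b3 :: real
  shows "\<exists>x y z. x\<^sup>2 + y\<^sup>2 + z\<^sup>2 = 1 \<and> 0 \<le> z \<and> a1 * x + a2 * y + a3 * z = 0 \<and> b1 * x + b2 * y + b3 * z = 0"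
proof -
  have perp: "\<exists>x y z. (x, y, z) \<noteq> (0, 0, 0) \<and> c1 * x + c2 * y + c3 * z = 0" for c1 c2 c3 :: real
  proof (cases "c1 = 0 \<and> c2 = 0")
    case True
    then show ?thesis by (intro exI[of _ 1] exI[of _ 0]) auto
  next
    case False
    then show ?thesis by (intro exI[of _ c2] exI[of _ "-c1"] exI[of _ 0]) auto
  qed
  have "\<exists>x y z. (x, y, z) \<noteq> (0, 0, 0) \<and> a1 * x + a2 * y + a3 * z = 0 \<and> b1 * x + b2 * y + b3 * z = 0"
  \<comment> \<open>The cross product is a witness unless the two vectors are parallel.\<close>
  proof (cases "a2 * b3 - a3 * b2 = 0 \<and> a3 * b1 - a1 * b3 = 0 \<and> a1 * b2 - a2 * b1 = 0")
    case False
    then show ?thesis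
      by (intro exI[of _ "a2 * b3 - a3 * b2"] exI[of _ "a3 * b1 - a1 * b3"] exI[of _ "a1 * b2 - a2 * b1"])
        (auto simp: algebra_simps)
  next
    case par: True
    show ?thesis
    proof (cases "a1 = 0 \<and> a2 = 0 \<and> a3 = 0")
      case True
      then show ?thesis using perp[of b1 b2 b3] by auto
    next
      case False
      obtain x y z where n: "(x, y, z) \<noteq> (0, 0, 0)" "a1 * x + a2 * y + a3 * z = 0"
        using perp by blast
      \<comment> \<open>For parallel vectors the right-hand sides vanish, so every coordinate of
        \<open>a\<close> annihilates the second scalar product, and one of them is nonzero.\<close>
      have "a1 * (b1 * x + b2 * y + b3 * z) - b1 * (a1 * x + a2 * y + a3 * z)
          = (a1 * b2 - a2 * b1) * y - (a3 * b1 - a1 * b3) * z"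
        "a2 * (b1 * x + b2 * y + b3 * z) - b2 * (a1 * x + a2 * y + a3 * z)
          = (a2 * b3 - a3 * b2) * z - (a1 * b2 - a2 * b1) * x"
        "a3 * (b1 * x + b2 * y + b3 * z) - b3 * (a1 * x + a2 * y + a3 * z)
          = (a3 * b1 - a1 * b3) * x - (a2 * b3 - a3 * b2) * y"
        by (simp_all add: algebra_simps)
      then have "b1 * x + b2 * y + b3 * z = 0" using par n(2) False by auto
      then show ?thesis using n by blast
    qed
  qed
  then obtain x y z where n: "(x, y, z) \<noteq> (0, 0, 0)" "a1 * x + a2 * y + a3 * z = 0"
    "b1 * x + b2 * y + b3 * z = 0" by blast
  \<comment> \<open>Normalises the vector and fixes the sign of its last coordinate.\<close>
  define s where "s = (if 0 \<le> z then 1 else -1) / sqrt (x\<^sup>2 + y\<^sup>2 + z\<^sup>2)"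
  have pos: "0 < x\<^sup>2 + y\<^sup>2 + z\<^sup>2"
  proof -
    have "x\<^sup>2 + y\<^sup>2 + z\<^sup>2 \<noteq> 0"
      using n(1) by (auto simp: add_nonneg_eq_0_iff)
    moreover have "0 \<le> x\<^sup>2 + y\<^sup>2 + z\<^sup>2" by simp
    ultimately show ?thesis by linarith
  qed
  have "s\<^sup>2 * (x\<^sup>2 + y\<^sup>2 + z\<^sup>2) = 1"
    using pos by (simp add: s_def power_divide)
  then have "(s * x)\<^sup>2 + (s * y)\<^sup>2 + (s * z)\<^sup>2 = 1" by (simp add: power_mult_distrib algebra_simps)
  moreover have "0 \<le> s * z" using pos by (simp add: s_def divide_nonpos_pos)
  moreover have "c1 * (s * x) + c2 * (s * y) + c3 * (s * z) = s * (c1 * x + c2 * y + c3 * z)" for c1 c2 c3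
    by (simp add: algebra_simps)
  ultimately show ?thesis using n(2,3) by (metis mult_zero_right)
qed

text \<open>The deviation of entry \<open>i\<close> from carrying the share \<open>r i\<close> of
  the squared norm. It is homogeneous, so it applies to unnormalised vectors; where all imbalances
  of a nonzero vector vanish, its normalisation has squared moduli \<open>r\<close>.\<close>

definition imbalance :: "(nat \<Rightarrow> real) \<Rightarrow> nat \<Rightarrow> (nat \<Rightarrow> complex) \<Rightarrow> nat \<Rightarrow> real" where
  "imbalance r d v i = (cmod (v i))\<^sup>2 - r i * (\<Sum>j<d. (cmod (v j))\<^sup>2)"

lemma imbalance_sum:
  assumes "(\<Sum>i<d. r i) = 1"
  shows "(\<Sum>i<d. imbalance r d v i) = 0"
  using assms by (simp add: imbalance_def sum_subtractf sum_distrib_right[symmetric])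

text \<open>
  A remixing of \<open>v\<close> and \<open>w\<close> by a special unitary matrix; \<open>(x, y, z)\<close> in the proof is its Bloch vector.
  The imbalances sum to \<open>0\<close>, so for \<open>d \<le> 3\<close> at most two of them have to be equalised.
\<close>

lemma balance_pair:
  fixes v w :: "nat \<Rightarrow> complex"
  assumes d: "d \<le> 3" and r: "(\<Sum>i<d. r i) = 1"
  obtains v' w' where "\<And>i j. v' i * cnj (v' j) + w' i * cnj (w' j) = v i * cnj (v j) + w i * cnj (w j)"
    and "\<And>i. i < d \<Longrightarrow> imbalance r d v' i = imbalance r d w' i"
proof -
  define g where "g i = cnj (v i) * w i" for i
  \<comment> \<open>The polarised imbalance of \<open>v\<close> and \<open>w\<close>; with
    \<open>D\<close> it determines the difference of imbalances after a rotation of the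
    pair.\<close>
  define c where "c i = g i - r i * (\<Sum>j<d. g j)" for i
  define D where "D i = imbalance r d v i - imbalance r d w i" for i
  obtain x y z where n: "x\<^sup>2 + y\<^sup>2 + z\<^sup>2 = 1" "0 \<le> z"
    and n0: "(2 * Re (c 0)) * x + (- 2 * Im (c 0)) * y + D 0 * z = 0"
    and n1: "(2 * Re (c 1)) * x + (- 2 * Im (c 1)) * y + D 1 * z = 0"
    using ex_orthogonal_unit3 by metis
  \<comment> \<open>This will be the imbalance of \<open>v'\<close> minus that of \<open>w'\<close>;
    it is linear in the Bloch vector.\<close>
  define L where "L i = z * D i + 2 * Re (Complex x y * c i)" for i
  have L01: "L 0 = 0" "L 1 = 0" using n0 n1 by (auto simp: L_def algebra_simps)
  have c_sum: "(\<Sum>i<d. c i) = 0"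
    using r by (simp add: c_def sum_subtractf sum_distrib_right[symmetric] of_real_sum[symmetric] del: of_real_sum)
  have "(\<Sum>i<d. L i) = z * (\<Sum>i<d. D i) + 2 * Re (Complex x y * (\<Sum>i<d. c i))"
    by (simp only: L_def sum.distrib sum_distrib_left Re_sum)
  also have "\<dots> = 0"
    unfolding c_sum by (simp add: D_def sum_subtractf imbalance_sum[OF r])
  finally have L_sum: "(\<Sum>i<d. L i) = 0" .
  have L: "L i = 0" if "i < d" for i
  proof (cases "i < 2")
    case True
    then show ?thesis using L01 by (auto simp: less_2_cases_iff)
  next
    case False
    then have "i = 2" "d = 3" using d that by auto
    then show ?thesis using L_sum L01 by (simp add: numeral_3_eq_3 numeral_2_eq_2)
  qed
  \<comment> \<open>Half-angle formulas: \<open>\<alpha>\<close> and \<open>\<beta>\<close> are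
    chosen such that the difference of their squared moduli is \<open>z\<close> and
    \<open>2 * \<alpha> * \<beta> = Complex x y\<close>.\<close>
  define \<alpha> where "\<alpha> = sqrt ((1 + z) / 2)"
  define \<beta> where "\<beta> = Complex x y / (2 * \<alpha>)"
  have \<alpha>: "0 < \<alpha>" "\<alpha>\<^sup>2 = (1 + z) / 2" using n(2) by (auto simp: \<alpha>_def)
  have \<beta>: "(cmod \<beta>)\<^sup>2 = (1 - z) / 2"
  proof -
    have "(cmod \<beta>)\<^sup>2 = (x\<^sup>2 + y\<^sup>2) / (4 * \<alpha>\<^sup>2)"
      using \<alpha>(1) by (simp add: \<beta>_def norm_divide norm_mult power_divide power_mult_distrib cmod_power2)
    also have "x\<^sup>2 + y\<^sup>2 = (1 - z) * (1 + z)" using n(1) by (simp add: algebra_simps power2_eq_square)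
    also have "4 * \<alpha>\<^sup>2 = 2 * (1 + z)" by (simp add: \<alpha>(2))
    finally show ?thesis using n(2) mult_divide_mult_cancel_right[of "1 + z" "1 - z" 2] by simp
  qed
  have \<alpha>\<beta>: "2 * \<alpha> * Re (\<beta> * t) = Re (Complex x y * t)" for t
    using \<alpha>(1) by (simp add: \<beta>_def field_simps)
  have unit: "of_real \<alpha> * of_real \<alpha> + \<beta> * cnj \<beta> = 1"
  proof -
    have "of_real \<alpha> * of_real \<alpha> + \<beta> * cnj \<beta> = of_real (\<alpha>\<^sup>2 + (cmod \<beta>)\<^sup>2)"
      by (simp only: of_real_add complex_norm_square) (simp add: power2_eq_square)
    then show ?thesis by (simp add: \<alpha>(2) \<beta> field_simps)
  qed
  define v' where "v' i = \<alpha> * v i + \<beta> * w i" for i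
  define w' where "w' i = - cnj \<beta> * v i + \<alpha> * w i" for i
  have "v' i * cnj (v' j) + w' i * cnj (w' j)
     = (of_real \<alpha> * of_real \<alpha> + \<beta> * cnj \<beta>) * (v i * cnj (v j) + w i * cnj (w j))" for i j
    by (simp add: v'_def w'_def algebra_simps)
  then have outer: "v' i * cnj (v' j) + w' i * cnj (w' j) = v i * cnj (v j) + w i * cnj (w j)" for i j
    by (simp add: unit)
  have "(cmod (v' i))\<^sup>2 - (cmod (w' i))\<^sup>2
      = z * ((cmod (v i))\<^sup>2 - (cmod (w i))\<^sup>2) + 2 * Re (Complex x y * g i)" for i
  proof -
    have "(cmod (v' i))\<^sup>2 - (cmod (w' i))\<^sup>2
        = (\<alpha>\<^sup>2 - (cmod \<beta>)\<^sup>2) * ((cmod (v i))\<^sup>2 - (cmod (w i))\<^sup>2) + 2 * (2 * \<alpha> * Re (\<beta> * g i))"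
      unfolding cmod_power2 v'_def w'_def g_def by (simp add: algebra_simps power2_eq_square)
    then show ?thesis unfolding \<alpha>\<beta> by (simp add: \<alpha>(2) \<beta> field_simps)
  qed
  then have diff: "(cmod (v' i))\<^sup>2 = (cmod (w' i))\<^sup>2
      + (z * ((cmod (v i))\<^sup>2 - (cmod (w i))\<^sup>2) + 2 * Re (Complex x y * g i))" for i
    by (simp add: algebra_simps)
  have "imbalance r d v' i - imbalance r d w' i = L i" for i
  proof -
    have "imbalance r d v' i - imbalance r d w' i = ((cmod (v' i))\<^sup>2 - (cmod (w' i))\<^sup>2)
        - r i * (\<Sum>j<d. (cmod (v' j))\<^sup>2 - (cmod (w' j))\<^sup>2)"
      by (simp add: imbalance_def sum_subtractf algebra_simps)
    also have "\<dots> = z * ((cmod (v i))\<^sup>2 - (cmod (w i))\<^sup>2) + 2 * Re (Complex x y * g i)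
        - r i * (z * (\<Sum>j<d. (cmod (v j))\<^sup>2 - (cmod (w j))\<^sup>2) + 2 * Re (Complex x y * (\<Sum>j<d. g j)))"
      by (simp only: diff add_diff_cancel_left' sum.distrib sum_distrib_left Re_sum)
    also have "\<dots> = L i"
      by (simp add: L_def D_def c_def imbalance_def sum_subtractf algebra_simps)
    finally show ?thesis .
  qed
  then show ?thesis using that[of v' w'] outer L by (metis eq_iff_diff_eq_0)
qed

text \<open>All components share the moduli \<open>sqrt_diag\<close> of the mixture, so the optimal
  value for a pure state is the same for each of them, and averaging loses nothing.\<close>

definition flat_decomposable :: "nat \<Rightarrow> (nat \<Rightarrow> nat \<Rightarrow> complex) \<Rightarrow> bool" where
  "flat_decomposable d A \<longleftrightarrow> (\<exists>(N :: nat) p \<psi>. (\<forall>k<N. 0 \<le> p k) \<and> (\<Sum>k<N. p k) = (1 :: real) \<and>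
     (\<forall>k<N. \<forall>i<d. (cmod (\<psi> k i))\<^sup>2 = Re (A i i)) \<and>
     (\<forall>i<d. \<forall>j<d. A i j = (\<Sum>k<N. of_real (p k) * (\<psi> k i * cnj (\<psi> k j)))))"

text \<open>Remixing two vectors unitarily preserves the sum of their outer products. Four such
  steps give vectors with a common imbalance, which is zero because the imbalances add up to zero;
  normalising the vectors yields the mixture.\<close>

lemma flat_decomposable_le3:
  assumes d: "d \<le> 3" and A: "psdf d A" and tr: "(\<Sum>i<d. Re (A i i)) = 1"
  shows "flat_decomposable d A"
proof -
  define r where "r i = Re (A i i)" for i
  have r1: "(\<Sum>i<d. r i) = 1" using tr by (simp add: r_def)
  obtain u where u: "\<And>i j. i < d \<Longrightarrow> j < d \<Longrightarrow> A i j = (\<Sum>k<d. u k i * cnj (u k j))"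
    using psdf_cholesky[OF A] by blast
  \<comment> \<open>Zero vectors fill the at most three vectors up to four, as the pairing below
    requires.\<close>
  define v where "v k = (if k < d then u k else (\<lambda>_. 0))" for k
  have v: "A i j = v 0 i * cnj (v 0 j) + v 1 i * cnj (v 1 j) + (v 2 i * cnj (v 2 j) + v 3 i * cnj (v 3 j))"
    if "i < d" "j < d" for i j
  proof -
    have "A i j = (\<Sum>k<d. v k i * cnj (v k j))"
      by (simp add: u[OF that] v_def)
    also have "\<dots> = (\<Sum>k<4. v k i * cnj (v k j))"
      using d by (intro sum.mono_neutral_left) (auto simp: v_def)
    finally show ?thesis by (simp add: eval_nat_numeral add.assoc)
  qed
  \<comment> \<open>Pairing four vectors along the edges of a square makes all imbalances equal, hence zero.\<close>
  obtain p q where pq: "\<And>i j. p i * cnj (p j) + q i * cnj (q j) = v 0 i * cnj (v 0 j) + v 1 i * cnj (v 1 j)"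
    "\<And>i. i < d \<Longrightarrow> imbalance r d p i = imbalance r d q i"
    by (rule balance_pair[OF d r1, where v = "v 0" and w = "v 1"]) (rule that)
  obtain s t where st: "\<And>i j. s i * cnj (s j) + t i * cnj (t j) = v 2 i * cnj (v 2 j) + v 3 i * cnj (v 3 j)"
    "\<And>i. i < d \<Longrightarrow> imbalance r d s i = imbalance r d t i"
    by (rule balance_pair[OF d r1, where v = "v 2" and w = "v 3"]) (rule that)
  obtain P S where PS: "\<And>i j. P i * cnj (P j) + S i * cnj (S j) = p i * cnj (p j) + s i * cnj (s j)"
    "\<And>i. i < d \<Longrightarrow> imbalance r d P i = imbalance r d S i"
    by (rule balance_pair[OF d r1, where v = "p" and w = "s"]) (rule that)
  obtain Q T where QT: "\<And>i j. Q i * cnj (Q j) + T i * cnj (T j) = q i * cnj (q j) + t i * cnj (t j)"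
    "\<And>i. i < d \<Longrightarrow> imbalance r d Q i = imbalance r d T i"
    by (rule balance_pair[OF d r1, where v = "q" and w = "t"]) (rule that)
  \<comment> \<open>The total imbalance of a pair depends only on the sum of its outer products, so
    remixing preserves it.\<close>
  have imb_add: "imbalance r d a i + imbalance r d b i = imbalance r d a' i + imbalance r d b' i"
    if "\<And>i j. a i * cnj (a j) + b i * cnj (b j) = a' i * cnj (a' j) + b' i * cnj (b' j)" for a b a' b' i
  proof -
    have e: "(cmod (a j))\<^sup>2 + (cmod (b j))\<^sup>2 = (cmod (a' j))\<^sup>2 + (cmod (b' j))\<^sup>2" for j
      using that[of j j] by (simp only: complex_norm_square[symmetric] of_real_add[symmetric] of_real_eq_iff)
    have "imbalance r d a i + imbalance r d b i = ((cmod (a i))\<^sup>2 + (cmod (b i))\<^sup>2)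
       - r i * (\<Sum>j<d. (cmod (a j))\<^sup>2 + (cmod (b j))\<^sup>2)" for a b
      by (simp add: imbalance_def sum.distrib algebra_simps)
    then show ?thesis by (simp only: e)
  qed
  define \<phi> where "\<phi> k = [P, S, Q, T] ! k" for k
  have \<phi>: "A i j = (\<Sum>k<4. \<phi> k i * cnj (\<phi> k j))" if "i < d" "j < d" for i j
  proof -
    have "A i j = (p i * cnj (p j) + q i * cnj (q j)) + (s i * cnj (s j) + t i * cnj (t j))"
      by (simp only: v[OF that] pq(1) st(1))
    also have "\<dots> = (p i * cnj (p j) + s i * cnj (s j)) + (q i * cnj (q j) + t i * cnj (t j))"
      by (simp only: ac_simps)
    also have "\<dots> = (P i * cnj (P j) + S i * cnj (S j)) + (Q i * cnj (Q j) + T i * cnj (T j))"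
      by (simp only: PS(1) QT(1))
    finally show ?thesis by (simp add: \<phi>_def eval_nat_numeral add.assoc)
  qed
  have r_eq: "r i = (\<Sum>k<4. (cmod (\<phi> k i))\<^sup>2)" if "i < d" for i
    unfolding r_def \<phi>[OF that that]
    by (simp only: complex_norm_square[symmetric] of_real_sum[symmetric] Re_complex_of_real)
  have "(\<Sum>k<4. imbalance r d (\<phi> k) i) = 0" if "i < d" for i
  proof -
    have "(\<Sum>k<4. imbalance r d (\<phi> k) i) = r i - r i * (\<Sum>k<4. \<Sum>j<d. (cmod (\<phi> k j))\<^sup>2)"
      by (simp add: imbalance_def sum_subtractf sum_distrib_left r_eq[OF that])
    also have "(\<Sum>k<4. \<Sum>j<d. (cmod (\<phi> k j))\<^sup>2) = (\<Sum>j<d. r j)"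
      by (subst sum.swap) (simp add: r_eq)
    finally show ?thesis by (simp add: r1)
  qed
  then have sum0: "imbalance r d P i + imbalance r d S i + imbalance r d Q i + imbalance r d T i = 0" if "i < d" for i
    using that by (simp add: \<phi>_def eval_nat_numeral)
  \<comment> \<open>Within each of the pairs \<open>P\<close>, \<open>S\<close> and
    \<open>Q\<close>, \<open>T\<close> the imbalances agree, and both pairs have the same total,
    since \<open>p\<close> agrees with \<open>q\<close> and \<open>s\<close> with \<open>t\<close>.
    All four are thus equal, with sum zero.\<close>
  have all0: "imbalance r d (\<phi> k) i = 0" if "i < d" "k < 4" for i k
  proof -
    have "imbalance r d P i + imbalance r d S i = imbalance r d p i + imbalance r d s i"
      by (rule imb_add) (rule PS(1))
    moreover have "imbalance r d Q i + imbalance r d T i = imbalance r d q i + imbalance r d t i"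
      by (rule imb_add) (rule QT(1))
    ultimately have "imbalance r d P i = 0" "imbalance r d S i = 0" "imbalance r d Q i = 0" "imbalance r d T i = 0"
      using sum0[OF that(1)] pq(2)[OF that(1)] st(2)[OF that(1)] PS(2)[OF that(1)] QT(2)[OF that(1)]
      by linarith+
    then show ?thesis using that(2) by (auto simp: \<phi>_def eval_nat_numeral less_Suc_eq)
  qed
  define n where "n k = (\<Sum>j<d. (cmod (\<phi> k j))\<^sup>2)" for k
  \<comment> \<open>A zero vector has weight \<open>0\<close>; any vector with the right moduli may
    stand in for its normalisation.\<close>
  define \<psi> where "\<psi> k i = (if n k = 0 then of_real (sqrt (r i)) else \<phi> k i / of_real (sqrt (n k)))" for k i
  have n0: "0 \<le> n k" for k by (simp add: n_def sum_nonneg)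
  have r0: "0 \<le> r i" if "i < d" for i by (simp add: r_eq[OF that] sum_nonneg)
  have flat: "(cmod (\<psi> k i))\<^sup>2 = r i" if "k < 4" "i < d" for k i
    using all0[OF that(2,1)] n0[of k] r0[OF that(2)]
    by (auto simp: \<psi>_def norm_divide power_divide imbalance_def n_def[symmetric])
  have "of_real (n k) * (\<psi> k i * cnj (\<psi> k j)) = \<phi> k i * cnj (\<phi> k j)" if "i < d" "j < d" for k i j
  proof (cases "n k = 0")
    case True
    then have "\<phi> k i = 0" using that(1) by (auto simp: n_def sum_nonneg_eq_0_iff)
    then show ?thesis using True by simp
  next
    case False
    have "of_real (sqrt (n k)) * of_real (sqrt (n k)) = (of_real (n k) :: complex)"
      using n0[of k] by (metis of_real_mult real_sqrt_mult_self abs_of_nonneg)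
    then show ?thesis using False by (simp add: \<psi>_def)
  qed
  then have "A i j = (\<Sum>k<4. of_real (n k) * (\<psi> k i * cnj (\<psi> k j)))" if "i < d" "j < d" for i j
    using that by (simp add: \<phi>[OF that])
  moreover have "(\<Sum>k<4. n k) = 1"
    unfolding n_def by (subst sum.swap) (simp add: r_eq[symmetric] r1)
  ultimately show ?thesis
    unfolding flat_decomposable_def using flat n0 by (intro exI[of _ 4] exI[of _ n] exI[of _ \<psi>]) (auto simp: r_def)
qed

lemma sum_div_mod:
  fixes f :: "nat \<Rightarrow> 'a :: comm_semiring_1"
  shows "(\<Sum>k<N * M. f (k div M) * g (k mod M)) = (\<Sum>k<N. f k) * (\<Sum>l<M. g l)"
  by (cases "M = 0") (simp_all add: sum_lessThan_mult sum_product)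

text \<open>Products of components form the mixture, and moduli multiply. With a real diagonal of
  \<open>A\<close>, the real part of a product of diagonal entries is the product of their real
  parts.\<close>

lemma flat_decomposable_kron:
  assumes A: "flat_decomposable a A" and B: "flat_decomposable b B"
    and C: "\<And>i j. i < a * b \<Longrightarrow> j < a * b \<Longrightarrow> C i j = A (i div b) (j div b) * B (i mod b) (j mod b)"
    and real: "\<And>i. i < a \<Longrightarrow> Im (A i i) = 0"
  shows "flat_decomposable (a * b) C"
proof -
  obtain N :: nat and p \<psi> where 1: "\<And>k. k < N \<Longrightarrow> 0 \<le> p k" "(\<Sum>k<N. p k) = (1 :: real)"
     "\<And>k i. k < N \<Longrightarrow> i < a \<Longrightarrow> (cmod (\<psi> k i))\<^sup>2 = Re (A i i)"
     "\<And>i j. i < a \<Longrightarrow> j < a \<Longrightarrow> A i j = (\<Sum>k<N. of_real (p k) * (\<psi> k i * cnj (\<psi> k j)))"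
    using A unfolding flat_decomposable_def by blast
  obtain M :: nat and q \<phi> where 2: "\<And>k. k < M \<Longrightarrow> 0 \<le> q k" "(\<Sum>k<M. q k) = (1 :: real)"
     "\<And>k i. k < M \<Longrightarrow> i < b \<Longrightarrow> (cmod (\<phi> k i))\<^sup>2 = Re (B i i)"
     "\<And>i j. i < b \<Longrightarrow> j < b \<Longrightarrow> B i j = (\<Sum>k<M. of_real (q k) * (\<phi> k i * cnj (\<phi> k j)))"
    using B unfolding flat_decomposable_def by blast
  have k: "k div M < N" "k mod M < M" if "k < N * M" for k
    using that by (auto simp: less_mult_imp_div_less intro!: mod_less_divisor gr0I)
  have i: "i div b < a" "i mod b < b" if "i < a * b" for i
    using that by (auto simp: less_mult_imp_div_less intro!: mod_less_divisor gr0I)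
  define P where "P k = p (k div M) * q (k mod M)" for k
  define \<Psi> where "\<Psi> k i = \<psi> (k div M) (i div b) * \<phi> (k mod M) (i mod b)" for k i
  have "C i j = (\<Sum>k<N * M. of_real (P k) * (\<Psi> k i * cnj (\<Psi> k j)))" if "i < a * b" "j < a * b" for i j
  proof -
    have "(\<Sum>k<N * M. of_real (P k) * (\<Psi> k i * cnj (\<Psi> k j)))
      = (\<Sum>k<N * M. (of_real (p (k div M)) * (\<psi> (k div M) (i div b) * cnj (\<psi> (k div M) (j div b)))) *
           (of_real (q (k mod M)) * (\<phi> (k mod M) (i mod b) * cnj (\<phi> (k mod M) (j mod b)))))"
      by (intro sum.cong) (auto simp: P_def \<Psi>_def mult_ac)
    also have "\<dots> = A (i div b) (j div b) * B (i mod b) (j mod b)"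
      using i[OF that(1)] i[OF that(2)]
        sum_div_mod[of "\<lambda>k. of_real (p k) * (\<psi> k (i div b) * cnj (\<psi> k (j div b)))" M
          "\<lambda>k. of_real (q k) * (\<phi> k (i mod b) * cnj (\<phi> k (j mod b)))" N]
      by (simp only: 1(4) 2(4))
    finally show ?thesis using C that by simp
  qed
  moreover have "(cmod (\<Psi> k j))\<^sup>2 = Re (C j j)" if "k < N * M" "j < a * b" for k j
    using k[OF that(1)] i[OF that(2)] 1(3) 2(3) real C[OF that(2,2)]
    by (simp add: \<Psi>_def norm_mult power_mult_distrib)
  moreover have "(\<Sum>k<N * M. P k) = 1"
    using sum_div_mod[of p M q N] 1(2) 2(2) by (simp add: P_def)
  moreover have "0 \<le> P k" if "k < N * M" for k
    using k[OF that] 1(1) 2(1) by (simp add: P_def)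
  ultimately show ?thesis
    unfolding flat_decomposable_def by blast
qed

section \<open>Mixtures of subsets\<close>

text \<open>Indicators of \<open>m\<close>-subsets are the vertices of the hypersimplex. Induction
  on the number of fractional coordinates: two of them can be moved against each other in both
  directions until one becomes integral, and \<open>r\<close> lies between the two points
  reached.\<close>

lemma hypersimplex_mixture:
  fixes r :: "'a \<Rightarrow> real"
  assumes I: "finite I" and r: "\<And>i. i \<in> I \<Longrightarrow> 0 \<le> r i \<and> r i \<le> 1" and sum: "(\<Sum>i\<in>I. r i) = real m"
  shows "\<exists>q. (\<forall>S. 0 \<le> q S) \<and> (\<forall>S. q S \<noteq> 0 \<longrightarrow> S \<subseteq> I \<and> card S = m) \<and>
    (\<Sum>S\<in>Pow I. q S) = (1 :: real) \<and> (\<forall>i\<in>I. (\<Sum>S\<in>Pow I. if i \<in> S then q S else 0) = r i)"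
  using r sum
proof (induction "card {i \<in> I. 0 < r i \<and> r i < 1}" arbitrary: r rule: less_induct)
  case less
  define Fr where "Fr = {i \<in> I. 0 < r i \<and> r i < 1}"
  define S1 where "S1 = {i \<in> I. r i = 1}"
  have fin: "finite Fr" "finite S1" using I by (auto simp: Fr_def S1_def)
  have "(\<Sum>i\<in>I. r i) = (\<Sum>i\<in>Fr \<union> S1. r i)"
  proof (intro sum.mono_neutral_right ballI)
    fix i assume "i \<in> I - (Fr \<union> S1)"
    then have "i \<in> I" "\<not> (0 < r i \<and> r i < 1)" "r i \<noteq> 1" by (auto simp: Fr_def S1_def)
    then show "r i = 0" using less.prems(1)[of i] by linarith
  qed (use I in \<open>auto simp: Fr_def S1_def\<close>)
  also have "\<dots> = (\<Sum>i\<in>Fr. r i) + (\<Sum>i\<in>S1. r i)"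
    using fin by (intro sum.union_disjoint) (auto simp: Fr_def S1_def)
  also have "(\<Sum>i\<in>S1. r i) = real (card S1)" by (simp add: S1_def)
  finally have split: "real m = (\<Sum>i\<in>Fr. r i) + real (card S1)" using less.prems(2) by simp
  show ?case
  proof (cases "Fr = {}")
    case True
    have r01: "r i = (if i \<in> S1 then 1 else 0)" if "i \<in> I" for i
    proof -
      have "\<not> (0 < r i \<and> r i < 1)" using True that by (auto simp: Fr_def)
      then have "r i = 0 \<or> r i = 1" using less.prems(1)[OF that] by linarith
      then show ?thesis using that by (auto simp: S1_def)
    qed
    have "S1 \<subseteq> I" "card S1 = m" using split True by (auto simp: S1_def)
    have "(\<Sum>S\<in>Pow I. if i \<in> S then if S = S1 then 1 else 0 else 0) = r i" if "i \<in> I" for i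
    proof -
      have "(\<Sum>S\<in>Pow I. if i \<in> S then if S = S1 then 1 else 0 else (0::real))
          = (\<Sum>S\<in>Pow I. if S = S1 then if i \<in> S1 then 1 else 0 else 0)"
        by (intro sum.cong) auto
      then show ?thesis using I r01[OF that] \<open>S1 \<subseteq> I\<close> by simp
    qed
    then show ?thesis
      using I \<open>S1 \<subseteq> I\<close> \<open>card S1 = m\<close>
      by (intro exI[of _ "\<lambda>S. if S = S1 then 1 else 0"]) auto
  next
    case False
    then obtain i where i: "i \<in> Fr" by blast
    \<comment> \<open>A single fractional coordinate would be an integer strictly between 0 and
      1.\<close>
    have "Fr \<noteq> {i}"
    proof
      assume "Fr = {i}"
      then have "r i = real m - real (card S1)" using split by simp
      then have "real_of_int (int m - int (card S1)) = r i" by simp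
      moreover have "0 < r i" "r i < 1" using i by (auto simp: Fr_def)
      ultimately have "0 < int m - int (card S1)" "int m - int (card S1) < 1" by linarith+
      then show False by linarith
    qed
    then obtain j where j: "j \<in> Fr" "j \<noteq> i" using i by blast
    have iI: "i \<in> I" "0 < r i" "r i < 1" and jI: "j \<in> I" "0 < r j" "r j < 1"
      using i j by (auto simp: Fr_def)
    \<comment> \<open>The amount \<open>e\<close> moved from \<open>k'\<close> to \<open>k\<close>
      is the largest one that stays in the cube: \<open>k\<close> reaches 1 or \<open>k'\<close>
      reaches 0, so the induction hypothesis applies.\<close>
    have move: "\<exists>q. (\<forall>S. 0 \<le> q S) \<and> (\<forall>S. q S \<noteq> 0 \<longrightarrow> S \<subseteq> I \<and> card S = m) \<and>
      (\<Sum>S\<in>Pow I. q S) = (1 :: real) \<and>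
      (\<forall>l\<in>I. (\<Sum>S\<in>Pow I. if l \<in> S then q S else 0) = (r(k := r k + e, k' := r k' - e)) l)"
      if k: "k \<in> Fr" "k' \<in> Fr" "k' \<noteq> k" and e: "e = min (1 - r k) (r k')" for k k' e
    proof (rule less.hyps)
      define r' where "r' = r(k := r k + e, k' := r k' - e)"
      have kI: "k \<in> I" "0 < r k" "r k < 1" "k' \<in> I" "0 < r k'" "r k' < 1"
        using k by (auto simp: Fr_def)
      have "{l \<in> I. 0 < r' l \<and> r' l < 1} \<subseteq> Fr"
        using kI k by (auto simp: r'_def Fr_def)
      moreover have "k \<notin> {l \<in> I. 0 < r' l \<and> r' l < 1} \<or> k' \<notin> {l \<in> I. 0 < r' l \<and> r' l < 1}"
        using k e by (auto simp: r'_def min_def)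
      ultimately have "{l \<in> I. 0 < r' l \<and> r' l < 1} \<subset> Fr" using k by blast
      then show "card {l \<in> I. 0 < (r(k := r k + e, k' := r k' - e)) l \<and> (r(k := r k + e, k' := r k' - e)) l < 1}
          < card {i \<in> I. 0 < r i \<and> r i < 1}"
        using psubset_card_mono[OF fin(1)] by (simp add: r'_def Fr_def)
      show "0 \<le> (r(k := r k + e, k' := r k' - e)) l \<and> (r(k := r k + e, k' := r k' - e)) l \<le> 1" if "l \<in> I" for l
        using less.prems(1)[OF that] kI e by auto
      have "(\<Sum>l\<in>I. r' l) = r' k + (r' k' + (\<Sum>l\<in>I - {k} - {k'}. r' l))"
        using I kI k by (simp add: sum.remove)
      also have "(\<Sum>l\<in>I - {k} - {k'}. r' l) = (\<Sum>l\<in>I - {k} - {k'}. r l)"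
        by (intro sum.cong) (auto simp: r'_def)
      also have "r' k + (r' k' + \<dots>) = r k + (r k' + (\<Sum>l\<in>I - {k} - {k'}. r l))"
        using k by (simp add: r'_def)
      also have "\<dots> = (\<Sum>l\<in>I. r l)"
        using I kI k by (simp add: sum.remove)
      finally show "(\<Sum>l\<in>I. (r(k := r k + e, k' := r k' - e)) l) = real m"
        using less.prems(2) by (simp add: r'_def)
    qed
    define e1 where "e1 = min (1 - r i) (r j)"
    define e2 where "e2 = min (1 - r j) (r i)"
    have e: "0 < e1" "0 < e2" using iI jI by (auto simp: e1_def e2_def)
    obtain q1 where q1: "\<And>S. 0 \<le> q1 S" "\<And>S. q1 S \<noteq> 0 \<Longrightarrow> S \<subseteq> I \<and> card S = m" "(\<Sum>S\<in>Pow I. q1 S) = (1 :: real)"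
      "\<And>l. l \<in> I \<Longrightarrow> (\<Sum>S\<in>Pow I. if l \<in> S then q1 S else 0) = (r(i := r i + e1, j := r j - e1)) l"
      using move[OF i j e1_def] by blast
    obtain q2 where q2: "\<And>S. 0 \<le> q2 S" "\<And>S. q2 S \<noteq> 0 \<Longrightarrow> S \<subseteq> I \<and> card S = m" "(\<Sum>S\<in>Pow I. q2 S) = (1 :: real)"
      "\<And>l. l \<in> I \<Longrightarrow> (\<Sum>S\<in>Pow I. if l \<in> S then q2 S else 0) = (r(j := r j + e2, i := r i - e2)) l"
      using move[OF j(1) i _ e2_def] j(2) by blast
    \<comment> \<open>The weight for which the two opposite moves cancel.\<close>
    define t where "t = e2 / (e1 + e2)"
    have t: "0 \<le> t" "t \<le> 1" "t * e1 = (1 - t) * e2" using e by (auto simp: t_def field_simps)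
    define q where "q S = t * q1 S + (1 - t) * q2 S" for S
    have lin: "(\<Sum>S\<in>Pow I. if P S then q S else 0)
      = t * (\<Sum>S\<in>Pow I. if P S then q1 S else 0) + (1 - t) * (\<Sum>S\<in>Pow I. if P S then q2 S else 0)" for P
      unfolding sum_distrib_left sum.distrib[symmetric] by (intro sum.cong) (auto simp: q_def)
    have "0 \<le> q S" for S using q1(1) q2(1) t by (simp add: q_def)
    moreover have "S \<subseteq> I \<and> card S = m" if "q S \<noteq> 0" for S
    proof -
      have "q1 S \<noteq> 0 \<or> q2 S \<noteq> 0" using that by (auto simp: q_def)
      then show ?thesis using q1(2) q2(2) by blast
    qed
    moreover have "(\<Sum>S\<in>Pow I. q S) = 1"
      using lin[of "\<lambda>_. True"] q1(3) q2(3) by simp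
    moreover have "(\<Sum>S\<in>Pow I. if l \<in> S then q S else 0) = r l" if "l \<in> I" for l
      unfolding lin q1(4)[OF that] q2(4)[OF that] using j(2) t(3) by (auto simp: algebra_simps)
    ultimately show ?thesis by blast
  qed
qed

text \<open>Intermediate value theorem in the level. At the smallest positive entry all positive
  entries are truncated to 1, and there are at least \<open>m\<close> of them; at a high enough
  level the sum is at most \<open>m\<close>.\<close>

lemma ex_truncation_level:
  fixes a :: "nat \<Rightarrow> real"
  assumes a: "\<And>i. i < d \<Longrightarrow> 0 \<le> a i" and m: "1 \<le> m" "m \<le> card {i. i < d \<and> 0 < a i}"
  shows "\<exists>c>0. (\<Sum>i<d. min ((a i)\<^sup>2 / c\<^sup>2) 1) = real m"
proof -
  define P where "P = {i. i < d \<and> 0 < a i}"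
  have "1 \<le> card P" using m unfolding P_def by (rule order_trans)
  then have P: "finite P" "P \<noteq> {}"
    by (metis card.infinite not_one_le_zero, metis card.empty not_one_le_zero)
  define l where "l = Min (a ` P)"
  have l: "0 < l" "\<And>i. i \<in> P \<Longrightarrow> l \<le> a i"
    using P by (auto simp: l_def P_def)
  define s where "s = (\<Sum>i<d. (a i)\<^sup>2)"
  have s: "0 \<le> s" by (simp add: s_def sum_nonneg)
  \<comment> \<open>Large enough for \<open>l \<le> u\<close> and for \<open>u\<^sup>2\<close> to be
    at least \<open>s / m\<close>.\<close>
  define u where "u = l + sqrt (s / m)"
  have u: "l \<le> u" using s by (simp add: u_def)
  define g where "g c = (\<Sum>i<d. min ((a i)\<^sup>2 / c\<^sup>2) 1)" for c
  have "real (card P) = (\<Sum>i\<in>P. min ((a i)\<^sup>2 / l\<^sup>2) 1)"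
  proof -
    have "min ((a i)\<^sup>2 / l\<^sup>2) 1 = 1" if "i \<in> P" for i
      using l(1) power_mono[OF l(2)[OF that], of 2] by (simp add: min_def field_simps)
    then show ?thesis by simp
  qed
  also have "\<dots> \<le> g l"
    unfolding g_def by (intro sum_mono2) (auto simp: P_def)
  finally have "real m \<le> g l" using m by (simp add: P_def)
  moreover have "g u \<le> real m"
  proof -
    have "s / m \<le> u\<^sup>2"
      using l(1) s by (simp add: u_def power2_sum)
    then have "s \<le> real m * u\<^sup>2" using m(1) by (simp add: field_simps)
    have "g u \<le> (\<Sum>i<d. (a i)\<^sup>2 / u\<^sup>2)"
      unfolding g_def by (intro sum_mono) auto
    also have "\<dots> = s / u\<^sup>2" by (simp add: s_def sum_divide_distrib)
    also have "\<dots> \<le> real m"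
      using \<open>s \<le> real m * u\<^sup>2\<close> l(1) u by (simp add: divide_le_eq)
    finally show ?thesis .
  qed
  moreover have "continuous_on {l..u} g"
    unfolding g_def using l(1) by (intro continuous_intros) auto
  ultimately obtain c where "l \<le> c" "g c = real m"
    using IVT2'[of g u "real m" l] u by auto
  then show ?thesis using l(1) by (intro exI[of _ c]) (auto simp: g_def)
qed

text \<open>
  Indices with \<open>r i = 0\<close> lie in no set of positive weight; the singleton \<open>{i}\<close> gets coefficient \<open>1\<close>
  for them, which keeps the Kraus operators below trace preserving.
\<close>

lemma mixture_coefficients:
  fixes a r :: "nat \<Rightarrow> real" and q :: "nat set \<Rightarrow> real"
  assumes q: "\<And>S. 0 \<le> q S" "\<And>S. q S \<noteq> 0 \<Longrightarrow> card S \<le> m" "(\<Sum>S\<in>Pow {..<d}. q S) = 1"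
    and r: "\<And>i. i < d \<Longrightarrow> (\<Sum>S\<in>Pow {..<d}. if i \<in> S then q S else 0) = r i"
    and a: "\<And>i. i < d \<Longrightarrow> r i = 0 \<Longrightarrow> a i = 0"
    and V: "\<And>S. S \<subseteq> {..<d} \<Longrightarrow> q S \<noteq> 0 \<Longrightarrow> (\<Sum>i\<in>S. a i / sqrt (r i)) = V"
    and m: "1 \<le> m"
  shows "\<exists>c :: nat set \<Rightarrow> nat \<Rightarrow> real. (\<forall>S i. c S i \<noteq> 0 \<longrightarrow> i \<in> S \<and> card S \<le> m) \<and>
    (\<forall>i<d. (\<Sum>S\<in>Pow {..<d}. (c S i)\<^sup>2) = 1) \<and>
    (\<Sum>S\<in>Pow {..<d}. (\<Sum>i<d. c S i * a i)\<^sup>2) = V\<^sup>2"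
proof -
  have r0: "0 \<le> r i" if "i < d" for i
    unfolding r[OF that, symmetric] using q(1) by (intro sum_nonneg) auto
  define c where "c S i = (if i \<notin> S then 0 else if r i = 0 then if S = {i} then 1 else 0 else sqrt (q S) / sqrt (r i))"
    for S i
  have "i \<in> S \<and> card S \<le> m" if "c S i \<noteq> 0" for S i
    using that q(2)[of S] m by (auto simp: c_def split: if_splits)
  moreover have "(\<Sum>S\<in>Pow {..<d}. (c S i)\<^sup>2) = 1" if i: "i < d" for i
  proof (cases "r i = 0")
    case True
    have "(\<Sum>S\<in>Pow {..<d}. (c S i)\<^sup>2) = (\<Sum>S\<in>Pow {..<d}. if S = {i} then 1 else 0)"
      using True by (intro sum.cong) (auto simp: c_def)
    then show ?thesis using i by simp
  next
    case False
    have "(\<Sum>S\<in>Pow {..<d}. (c S i)\<^sup>2) = (\<Sum>S\<in>Pow {..<d}. if i \<in> S then q S else 0) / r i"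
      unfolding sum_divide_distrib
      using False q(1) r0[OF i] by (intro sum.cong) (auto simp: c_def power_divide)
    then show ?thesis using False r[OF i] by simp
  qed
  \<comment> \<open>Coefficients at indices with \<open>r i = 0\<close> meet \<open>a i = 0\<close>;
    the remaining ones give \<open>sqrt (q S)\<close> times the common amplitude.\<close>
  moreover have "(\<Sum>i<d. c S i * a i)\<^sup>2 = q S * V\<^sup>2" if S: "S \<subseteq> {..<d}" for S
  proof -
    have "(\<Sum>i<d. c S i * a i) = (\<Sum>i\<in>S. sqrt (q S) * (a i / sqrt (r i)))"
      using S a by (intro sum.mono_neutral_cong_right) (auto simp: c_def)
    also have "\<dots> = sqrt (q S) * (\<Sum>i\<in>S. a i / sqrt (r i))"
      by (simp add: sum_distrib_left)
    finally show ?thesis using V[OF S] q(1)[of S] by (cases "q S = 0") (auto simp: power_mult_distrib)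
  qed
  then have "(\<Sum>S\<in>Pow {..<d}. (\<Sum>i<d. c S i * a i)\<^sup>2) = V\<^sup>2"
    using q(3) by (simp add: sum_distrib_right[symmetric])
  ultimately show ?thesis by (intro exI[of _ c]) auto
qed

text \<open>If at least \<open>m\<close> entries are positive, \<open>x\<close> is \<open>a\<close>
  cut off at the truncation level and the sets come from the hypersimplex. Otherwise one set holds
  all positive entries, and \<open>x = 0\<close> gives the square of the l1 norm.\<close>

lemma ex_optimal_coefficients:
  fixes a :: "nat \<Rightarrow> real"
  assumes a: "\<And>i. i < d \<Longrightarrow> 0 \<le> a i" and m: "1 \<le> m"
  shows "\<exists>(c :: nat set \<Rightarrow> nat \<Rightarrow> real) x. (\<forall>S i. c S i \<noteq> 0 \<longrightarrow> i \<in> S \<and> card S \<le> m) \<and>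
    (\<forall>i<d. (\<Sum>S\<in>Pow {..<d}. (c S i)\<^sup>2) = 1) \<and>
    (\<Sum>S\<in>Pow {..<d}. (\<Sum>i<d. c S i * a i)\<^sup>2)
      = ((\<Sum>i<d. \<bar>a i - x i\<bar>) + sqrt m * sqrt (\<Sum>i<d. (x i)\<^sup>2))\<^sup>2"
proof (cases "m \<le> card {i. i < d \<and> 0 < a i}")
  case True
  obtain t where t: "0 < t" "(\<Sum>i<d. min ((a i)\<^sup>2 / t\<^sup>2) 1) = real m"
    using ex_truncation_level[OF a m True] by auto
  define r where "r i = min ((a i)\<^sup>2 / t\<^sup>2) 1" for i
  define x where "x i = min (a i) t" for i
  obtain q where q: "\<And>S. 0 \<le> q S" "\<And>S. q S \<noteq> 0 \<Longrightarrow> S \<subseteq> {..<d} \<and> card S = m" "(\<Sum>S\<in>Pow {..<d}. q S) = (1 :: real)"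
    "\<And>i. i < d \<Longrightarrow> (\<Sum>S\<in>Pow {..<d}. if i \<in> S then q S else 0) = r i"
    using hypersimplex_mixture[of "{..<d}" r m] t by (auto simp: r_def)
  have r_sq: "r i = (x i / t)\<^sup>2" if "i < d" for i
    using a[OF that] t(1) power_mono[of "a i" t 2] power_mono[of t "a i" 2]
    by (cases "a i \<le> t") (auto simp: r_def x_def min_def power_divide)
  have r_sqrt: "sqrt (r i) = x i / t" if "i < d" for i
    unfolding r_sq[OF that] using a[OF that] t(1) by (simp add: x_def)
  have x2: "sqrt (real m) * sqrt (\<Sum>i<d. (x i)\<^sup>2) = m * t"
  proof -
    have "(x i)\<^sup>2 = t\<^sup>2 * r i" if "i < d" for i
      using t(1) by (simp add: r_sq[OF that] power_divide)
    then have "(\<Sum>i<d. (x i)\<^sup>2) = t\<^sup>2 * m"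
      using t(2) by (simp add: sum_distrib_left[symmetric] r_def)
    then show ?thesis using t(1) by (simp add: real_sqrt_mult)
  qed
  \<comment> \<open>Each of the \<open>m\<close> elements of \<open>S\<close> contributes
    \<open>t\<close> plus its excess over \<open>t\<close>. An index outside \<open>S\<close> has no
    excess, so the sum does not depend on \<open>S\<close>.\<close>
  have V: "(\<Sum>i\<in>S. a i / sqrt (r i)) = (\<Sum>i<d. \<bar>a i - x i\<bar>) + m * t"
    if S: "S \<subseteq> {..<d}" "q S \<noteq> 0" for S
  proof -
    have fin: "finite S" using S(1) finite_subset by blast
    have q0: "0 < q S" using q(1)[of S] S(2) by linarith
    have "a i / sqrt (r i) = \<bar>a i - x i\<bar> + t" if "i \<in> S" for i
    proof -
      have i: "i < d" using S that by auto
      have "q S \<le> (\<Sum>S\<in>Pow {..<d}. if i \<in> S then q S else 0)"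
        using S that q(1) member_le_sum[of S "Pow {..<d}" "\<lambda>S. if i \<in> S then q S else 0"] by simp
      then have "0 < r i" using q(4)[OF i] q0 by simp
      then have "0 < sqrt (r i)" by simp
      then have "0 < x i" using r_sqrt[OF i] t(1) by (simp add: zero_less_divide_iff)
      then show ?thesis unfolding r_sqrt[OF i] using t(1) by (auto simp: x_def min_def field_simps)
    qed
    then have "(\<Sum>i\<in>S. a i / sqrt (r i)) = (\<Sum>i\<in>S. \<bar>a i - x i\<bar>) + m * t"
      using q(2)[OF S(2)] by (simp add: sum.distrib)
    also have "(\<Sum>i\<in>S. \<bar>a i - x i\<bar>) = (\<Sum>i<d. \<bar>a i - x i\<bar>)"
    proof (intro sum.mono_neutral_left ballI)
      fix i assume i: "i \<in> {..<d} - S"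
      \<comment> \<open>An index with \<open>r i = 1\<close> lies in every set of positive weight,
        in particular in \<open>S\<close>.\<close>
      have "r i \<noteq> 1"
      proof
        assume "r i = 1"
        have "(\<Sum>S\<in>Pow {..<d}. if i \<in> S then 0 else q S)
            = (\<Sum>S\<in>Pow {..<d}. q S) - (\<Sum>S\<in>Pow {..<d}. if i \<in> S then q S else 0)"
          unfolding sum_subtractf[symmetric] by (intro sum.cong) auto
        then have "(\<Sum>S\<in>Pow {..<d}. if i \<in> S then 0 else q S) = 0"
          using q(3) q(4)[of i] i \<open>r i = 1\<close> by simp
        then have "(if i \<in> S then 0 else q S) = 0"
          using q(1) S(1) by (subst (asm) sum_nonneg_eq_0_iff) auto
        then show False using i S(2) by simp
      qed
      then have "(a i)\<^sup>2 < t\<^sup>2" using t(1) by (auto simp: r_def min_def split: if_splits)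
      then have "a i < t" using t(1) by (meson power2_less_imp_less less_imp_le)
      then show "\<bar>a i - x i\<bar> = 0" by (simp add: x_def)
    qed (use S in auto)
    finally show ?thesis .
  qed
  have "a i = 0" if "i < d" "r i = 0" for i
    using that t(1) by (auto simp: r_def min_def split: if_splits)
  then have "\<exists>c :: nat set \<Rightarrow> nat \<Rightarrow> real. (\<forall>S i. c S i \<noteq> 0 \<longrightarrow> i \<in> S \<and> card S \<le> m) \<and>
    (\<forall>i<d. (\<Sum>S\<in>Pow {..<d}. (c S i)\<^sup>2) = 1) \<and>
    (\<Sum>S\<in>Pow {..<d}. (\<Sum>i<d. c S i * a i)\<^sup>2) = ((\<Sum>i<d. \<bar>a i - x i\<bar>) + m * t)\<^sup>2"
    using q V m by (intro mixture_coefficients[of q m d r]) auto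
  then show ?thesis unfolding x2[symmetric] by blast
next
  case False
  \<comment> \<open>Fewer than \<open>m\<close> positive entries: all weight goes to their
    set.\<close>
  define S0 where "S0 = {i. i < d \<and> 0 < a i}"
  define r where "r i = (if i \<in> S0 then 1 else 0 :: real)" for i
  define q where "q S = (if S = S0 then 1 else 0 :: real)" for S
  have S0: "S0 \<subseteq> {..<d}" by (auto simp: S0_def)
  have r: "(\<Sum>S\<in>Pow {..<d}. if i \<in> S then q S else 0) = r i" for i
  proof -
    have "(\<Sum>S\<in>Pow {..<d}. if i \<in> S then q S else 0) = (\<Sum>S\<in>Pow {..<d}. if S = S0 then r i else 0)"
      by (intro sum.cong) (auto simp: q_def r_def)
    then show ?thesis using S0 by simp
  qed
  have a0: "a i = 0" if "i < d" "r i = 0" for i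
    using that a[OF that(1)] by (auto simp: r_def S0_def split: if_splits)
  have "(\<Sum>i\<in>S0. a i / sqrt (r i)) = (\<Sum>i<d. \<bar>a i\<bar>)"
    using S0 a a0 by (intro sum.mono_neutral_cong_left) (auto simp: r_def)
  then have "\<exists>c :: nat set \<Rightarrow> nat \<Rightarrow> real. (\<forall>S i. c S i \<noteq> 0 \<longrightarrow> i \<in> S \<and> card S \<le> m) \<and>
    (\<forall>i<d. (\<Sum>S\<in>Pow {..<d}. (c S i)\<^sup>2) = 1) \<and>
    (\<Sum>S\<in>Pow {..<d}. (\<Sum>i<d. c S i * a i)\<^sup>2) = (\<Sum>i<d. \<bar>a i\<bar>)\<^sup>2"
    using False S0 r a0 m
    by (intro mixture_coefficients[of q m d r]) (auto simp: q_def S0_def split: if_splits)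
  then show ?thesis by (elim exE) (rule exI, rule exI[of _ "\<lambda>_. 0"], simp)
qed

section \<open>Upper bound\<close>

lemma mat_adjoint_carrier [simp]: "A \<in> carrier_mat n k \<Longrightarrow> mat_adjoint A \<in> carrier_mat k n"
  by (auto simp: mat_adjoint_def)

lemma mat_adjoint_dim [simp]: "dim_row (mat_adjoint A) = dim_col A" "dim_col (mat_adjoint A) = dim_row A"
  by (auto simp: mat_adjoint_def)

lemma mat_adjoint_index [simp]:
  fixes A :: "complex mat"
  assumes "i < dim_col A" "j < dim_row A"
  shows "mat_adjoint A $$ (i, j) = cnj (A $$ (j, i))"
  using assms by (simp add: mat_adjoint_def mat_of_rows_def)

lemma qform_mat:
  assumes "A \<in> carrier_mat d d" "v \<in> carrier_vec d"
  shows "(A *\<^sub>v v) \<bullet>c v = qform d (\<lambda>i j. A $$ (i, j)) (\<lambda>i. v $ i)"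
proof -
  have "(A *\<^sub>v v) \<bullet>c v = (\<Sum>i<d. (\<Sum>j<d. A $$ (i, j) * v $ j) * cnj (v $ i))"
    using assms by (simp add: scalar_prod_def lessThan_atLeast0)
  then show ?thesis
    by (simp add: qform_def sum_distrib_left mult_ac)
qed

lemma psd_iff_psdf: "psd d A \<longleftrightarrow> A \<in> carrier_mat d d \<and> psdf d (\<lambda>i j. A $$ (i, j))"
proof -
  have "qform d B u = qform d B (\<lambda>i. vec d u $ i)" for B u
    by (simp add: qform_def)
  then show ?thesis
    unfolding psd_def psdf_def by (metis qform_mat vec_carrier)
qed

text \<open>Unnormalised rank-one operators: the forms attached to channels have to be evaluated at
  arbitrary vectors, not only at states.\<close>

definition outer :: "nat \<Rightarrow> (nat \<Rightarrow> complex) \<Rightarrow> complex mat" where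
  "outer d u = mat d d (\<lambda>(i, j). u i * cnj (u j))"

lemma outer_carrier [simp]: "outer d u \<in> carrier_mat d d"
  by (simp add: outer_def)

lemma psd_outer: "psd d (outer d u)"
  unfolding psd_iff_psdf psdf_def
proof safe
  fix w
  have "qform d (\<lambda>i j. outer d u $$ (i, j)) w = (\<Sum>i<d. cnj (w i) * u i) * (\<Sum>j<d. cnj (u j) * w j)"
    by (simp add: qform_def outer_def sum_product mult_ac)
  also have "(\<Sum>j<d. cnj (u j) * w j) = cnj (\<Sum>i<d. cnj (w i) * u i)"
    by (simp add: mult.commute)
  also have "(\<Sum>i<d. cnj (w i) * u i) * \<dots> = of_real ((cmod (\<Sum>i<d. cnj (w i) * u i))\<^sup>2)"
    by (rule complex_norm_square[symmetric])
  finally show "0 \<le> qform d (\<lambda>i j. outer d u $$ (i, j)) w"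
    by (simp add: less_eq_complex_def)
qed simp

lemma proj_eq_outer: "v \<in> carrier_vec d \<Longrightarrow> proj v = outer d (\<lambda>i. v $ i)"
  by (auto simp: proj_def outer_def)

lemma mtrace_outer: "mtrace (outer d u) = of_real (\<Sum>i<d. (cmod (u i))\<^sup>2)"
  by (simp add: mtrace_def outer_def complex_norm_square del: of_real_power)

text \<open>Up to conjugation, \<open>m\<close> times the overlap with the maximally coherent state;
  keeping the factor \<open>m\<close> avoids the roots in \<open>max_coherent\<close>.\<close>

definition entry_sum :: "nat \<Rightarrow> complex mat \<Rightarrow> complex" where
  "entry_sum m Z = (\<Sum>i<m. \<Sum>j<m. Z $$ (i, j))"

text \<open>The entry sum is the form at the all-ones vector. For the upper bound, test vectors with
  entries 1 and -1 at \<open>i\<close> and \<open>j\<close> bound each off-diagonal entry by two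
  diagonal ones.\<close>

lemma psd_entry_sum:
  assumes "psd m Z"
  shows "0 \<le> entry_sum m Z" "Re (entry_sum m Z) \<le> m * Re (mtrace Z)"
proof -
  have Z: "Z \<in> carrier_mat m m" "psdf m (\<lambda>i j. Z $$ (i, j))"
    using assms by (auto simp: psd_iff_psdf)
  have "entry_sum m Z = qform m (\<lambda>i j. Z $$ (i, j)) (\<lambda>_. 1)"
    by (simp add: entry_sum_def qform_def)
  then show "0 \<le> entry_sum m Z"
    using Z(2) by (simp add: psdf_def)
  have off: "2 * Re (Z $$ (i, j)) \<le> Re (Z $$ (i, i)) + Re (Z $$ (j, j))" if "i < m" "j < m" for i j
  proof (cases "i = j")
    case False
    have "0 \<le> qform m (\<lambda>i j. Z $$ (i, j)) ((\<lambda>_. 0)(i := 1, j := -1))"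
      using Z(2) by (simp add: psdf_def)
    then show ?thesis
      unfolding qform_two[OF that False] using psdf_hermitian[OF Z(2) that]
      by (simp add: less_eq_complex_def)
  qed simp
  have "2 * Re (entry_sum m Z) = (\<Sum>i<m. \<Sum>j<m. 2 * Re (Z $$ (i, j)))"
    by (simp add: entry_sum_def sum_distrib_left)
  also have "\<dots> \<le> (\<Sum>i<m. \<Sum>j<m. Re (Z $$ (i, i)) + Re (Z $$ (j, j)))"
    using off by (intro sum_mono) auto
  also have "\<dots> = 2 * (m * Re (mtrace Z))"
    using Z(1) by (simp add: mtrace_def sum.distrib sum_distrib_left)
  finally show "Re (entry_sum m Z) \<le> m * Re (mtrace Z)" by simp
qed

lemma hs_inner_max_coherent:
  assumes Z: "Z \<in> carrier_mat m m"
  shows "hs_inner Z (proj (max_coherent m)) = cnj (entry_sum m Z) / m"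
proof -
  have sq: "of_real (sqrt m) * of_real (sqrt m) = (of_nat m :: complex)"
    by (metis abs_of_nat of_real_mult of_real_of_nat_eq real_sqrt_mult_self)
  have P: "proj (max_coherent m) = mat m m (\<lambda>(i, j). 1 / of_nat m)"
    by (intro eq_matI) (auto simp: proj_def max_coherent_def sq)
  have "hs_inner Z (proj (max_coherent m)) = (\<Sum>i<m. \<Sum>j<m. cnj (Z $$ (j, i)) / m)"
    unfolding hs_inner_def mtrace_def P using Z
    by (simp add: scalar_prod_def lessThan_atLeast0)
  also have "\<dots> = (\<Sum>j<m. \<Sum>i<m. cnj (Z $$ (j, i)) / m)" by (rule sum.swap)
  finally show ?thesis by (simp add: entry_sum_def sum_divide_distrib)
qed

definition mat_unit :: "nat \<Rightarrow> nat \<Rightarrow> nat \<Rightarrow> complex mat" where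
  "mat_unit d i j = mat d d (\<lambda>ij. if ij = (i, j) then 1 else 0)"

text \<open>Induction on the set of positions kept, starting from the zero matrix and adding one
  multiple of a matrix unit at a time.\<close>

lemma linear_functional_expand:
  fixes f :: "complex mat \<Rightarrow> complex"
  assumes add: "\<And>X Y. X \<in> carrier_mat d d \<Longrightarrow> Y \<in> carrier_mat d d \<Longrightarrow> f (X + Y) = f X + f Y"
    and smult: "\<And>c X. X \<in> carrier_mat d d \<Longrightarrow> f (c \<cdot>\<^sub>m X) = c * f X"
    and X: "X \<in> carrier_mat d d"
  shows "f X = (\<Sum>i<d. \<Sum>j<d. X $$ (i, j) * f (mat_unit d i j))"
proof -
  have part: "f (mat d d (\<lambda>ij. if ij \<in> A then X $$ ij else 0)) = (\<Sum>(i, j)\<in>A. X $$ (i, j) * f (mat_unit d i j))"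
    if "finite A" "A \<subseteq> {..<d} \<times> {..<d}" for A
    using that
  proof (induction A)
    case empty
    have "mat d d (\<lambda>ij. if ij \<in> {} then X $$ ij else 0) = 0 \<cdot>\<^sub>m (0\<^sub>m d d :: complex mat)"
      by auto
    then show ?case using smult[of "0\<^sub>m d d" 0] by simp
  next
    case (insert ab A)
    obtain a b where ab: "ab = (a, b)" by (cases ab)
    have "mat d d (\<lambda>ij. if ij \<in> insert ab A then X $$ ij else 0)
      = X $$ (a, b) \<cdot>\<^sub>m mat_unit d a b + mat d d (\<lambda>ij. if ij \<in> A then X $$ ij else 0)"
      using insert.hyps by (intro eq_matI) (auto simp: ab mat_unit_def)
    then show ?case
      using insert by (simp add: add smult mat_unit_def ab)
  qed
  have "X = mat d d (\<lambda>ij. if ij \<in> {..<d} \<times> {..<d} then X $$ ij else 0)"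
    using X by auto
  then have "f X = f (mat d d (\<lambda>ij. if ij \<in> {..<d} \<times> {..<d} then X $$ ij else 0))" by (rule arg_cong)
  then show ?thesis using part[of "{..<d} \<times> {..<d}"] by (simp add: sum.cartesian_product)
qed

lemma entry_sum_add:
  "X \<in> carrier_mat m m \<Longrightarrow> Y \<in> carrier_mat m m \<Longrightarrow> entry_sum m (X + Y) = entry_sum m X + entry_sum m Y"
  by (simp add: entry_sum_def sum.distrib)

lemma entry_sum_smult: "X \<in> carrier_mat m m \<Longrightarrow> entry_sum m (c \<cdot>\<^sub>m X) = c * entry_sum m X"
  by (simp add: entry_sum_def sum_distrib_left)

text \<open>Complete positivity with a one-dimensional ancilla, where the ampliation is the map
  itself.\<close>

lemma channel_psd:
  assumes "channel d m \<E>" "psd d X"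
  shows "psd m (\<E> X)"
proof -
  have X: "X \<in> carrier_mat d d" and EX: "\<E> X \<in> carrier_mat m m"
    using assms by (auto simp: psd_def channel_def linear_map_def)
  have "mat d d (\<lambda>(i, j). X $$ (0 * d + i, 0 * d + j)) = X"
    using X by auto
  then have "ampliation 1 d m \<E> X = \<E> X"
    using EX by (intro eq_matI) (auto simp: ampliation_def)
  then show ?thesis
    using assms by (metis channel_def completely_positive_def mult_1)
qed

text \<open>By linearity the overlap is a quadratic form in \<open>u\<close>. The indices of
  \<open>mat_unit\<close> are exchanged because \<open>outer\<close> conjugates its second index and
  \<open>qform\<close> its first.\<close>

lemma channel_entry_sum:
  assumes "channel d m \<E>"
  shows "entry_sum m (\<E> (outer d u)) = qform d (\<lambda>i j. entry_sum m (\<E> (mat_unit d j i))) u"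
proof -
  have "entry_sum m (\<E> (outer d u)) = (\<Sum>i<d. \<Sum>j<d. outer d u $$ (i, j) * entry_sum m (\<E> (mat_unit d i j)))"
    using assms by (intro linear_functional_expand) (auto simp: channel_def linear_map_def entry_sum_add entry_sum_smult)
  also have "\<dots> = (\<Sum>i<d. \<Sum>j<d. u i * cnj (u j) * entry_sum m (\<E> (mat_unit d i j)))"
    by (simp add: outer_def)
  also have "\<dots> = (\<Sum>j<d. \<Sum>i<d. u i * cnj (u j) * entry_sum m (\<E> (mat_unit d i j)))"
    by (rule sum.swap)
  finally show ?thesis by (simp add: qform_def mult_ac)
qed

lemma incoherent_mat_unit:
  assumes "i < d"
  shows "incoherent_state d (mat_unit d i i)"
proof -
  have "mat_unit d i i = outer d (\<lambda>k. if k = i then 1 else 0)"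
    by (auto simp: mat_unit_def outer_def)
  then have "psd d (mat_unit d i i)" by (simp add: psd_outer)
  moreover have "mtrace (mat_unit d i i) = 1"
    using assms by (simp add: mtrace_def mat_unit_def)
  ultimately have "density_op d (mat_unit d i i)" by (simp add: density_op_def)
  moreover have "mat_unit d i i = dephase (mat_unit d i i)"
    by (auto simp: mat_unit_def dephase_def)
  ultimately show ?thesis by (simp add: incoherent_state_def)
qed

lemma channel_density:
  assumes "channel d m \<E>" "density_op d \<sigma>"
  shows "density_op m (\<E> \<sigma>)"
  using assms channel_psd[OF assms(1)] by (auto simp: density_op_def channel_def psd_def)

section \<open>Inclusion of all classes in MIO\<close>

lemma DIO_subset_MIO: "DIO d m \<subseteq> MIO d m"
proof
  fix \<E> assume E: "\<E> \<in> DIO d m"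
  have "incoherent_state m (\<E> \<sigma>)" if "incoherent_state d \<sigma>" for \<sigma>
  proof -
    have "\<sigma> \<in> carrier_mat d d" using that by (auto simp: incoherent_state_def density_op_def psd_def)
    then show ?thesis
      using that E channel_density[of d m \<E> \<sigma>] by (auto simp: incoherent_state_def DIO_def)
  qed
  then show "\<E> \<in> MIO d m" using E by (auto simp: DIO_def MIO_def)
qed

lemma SIO_subset_IO: "SIO d m \<subseteq> IO d m"
  unfolding SIO_def IO_def by blast

text \<open>Each Kraus term of an incoherent state is diagonal, hence so is their sum.\<close>

lemma IO_subset_MIO: "IO d m \<subseteq> MIO d m"
proof
  fix \<E> assume E: "\<E> \<in> IO d m"
  obtain N K where K: "kraus_decomposition d m \<E> N K" "\<And>l. l < N \<Longrightarrow> incoherent_op (K l)"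
    using E unfolding IO_def by blast
  have "incoherent_state m (\<E> \<sigma>)" if s: "incoherent_state d \<sigma>" for \<sigma>
  proof -
    have c: "\<sigma> \<in> carrier_mat d d" using s by (auto simp: incoherent_state_def density_op_def psd_def)
    have dens: "density_op m (\<E> \<sigma>)"
      using s E channel_density[of d m \<E> \<sigma>] by (auto simp: incoherent_state_def IO_def)
    have "\<E> \<sigma> = mat_sum m m (\<lambda>l. K l * \<sigma> * mat_adjoint (K l)) {..<N}"
      using K(1) c by (auto simp: kraus_decomposition_def)
    moreover have "(K l * \<sigma> * mat_adjoint (K l)) $$ (i, j) = 0" if "l < N" "i < m" "j < m" "i \<noteq> j" for l i j
    proof -
      have "K l \<in> carrier_mat m d" using K(1) that by (auto simp: kraus_decomposition_def)
      then show ?thesis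
        using K(2)[OF that(1)] s that unfolding incoherent_op_def diagonal_mat_def by auto
    qed
    ultimately have "\<E> \<sigma> = dephase (\<E> \<sigma>)"
      by (intro eq_matI) (auto simp: dephase_def mat_sum_def)
    then show ?thesis using dens by (simp add: incoherent_state_def)
  qed
  then show "\<E> \<in> MIO d m" using E by (auto simp: IO_def MIO_def)
qed

text \<open>The image of a basis state is diagonal, so its entry sum is its trace.\<close>

lemma MIO_entry_sum_diag:
  assumes E: "\<E> \<in> MIO d m" and i: "i < d"
  shows "entry_sum m (\<E> (mat_unit d i i)) = 1"
proof -
  have s: "incoherent_state m (\<E> (mat_unit d i i))"
    using E incoherent_mat_unit[OF i] by (auto simp: MIO_def)
  define Z where "Z = \<E> (mat_unit d i i)"
  have Z: "Z \<in> carrier_mat m m" "mtrace Z = 1" "Z = dephase Z"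
    using s by (auto simp: Z_def incoherent_state_def density_op_def psd_def)
  have "Z $$ (a, b) = (if a = b then Z $$ (a, a) else 0)" if "a < m" "b < m" for a b
    using that Z(1) by (subst Z(3)) (auto simp: dephase_def)
  then have "entry_sum m Z = (\<Sum>a<m. \<Sum>b<m. if a = b then Z $$ (a, a) else 0)"
    unfolding entry_sum_def by (intro sum.cong) auto
  also have "\<dots> = mtrace Z" using Z(1) by (simp add: mtrace_def)
  finally show ?thesis using Z(2) by (simp add: Z_def)
qed

lemma fidelity_value:
  assumes "\<And>k. k < N \<Longrightarrow> channel d m (\<Lambda> k)" "\<And>k. k < N \<Longrightarrow> \<psi> k \<in> carrier_vec d"
  shows "Re (hs_inner (mat_sum m m (\<lambda>k. complex_of_real (p k) \<cdot>\<^sub>m \<Lambda> k (proj (\<psi> k))) {..<N}) (proj (max_coherent m)))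
    = (\<Sum>k<N. p k * Re (entry_sum m (\<Lambda> k (outer d (\<lambda>i. \<psi> k $ i))))) / m"
proof -
  have c: "\<Lambda> k (proj (\<psi> k)) \<in> carrier_mat m m" if "k < N" for k
    using assms that by (auto simp: channel_def linear_map_def proj_eq_outer[of _ d])
  have "entry_sum m (mat_sum m m (\<lambda>k. complex_of_real (p k) \<cdot>\<^sub>m \<Lambda> k (proj (\<psi> k))) {..<N})
      = (\<Sum>i<m. \<Sum>j<m. \<Sum>k<N. of_real (p k) * \<Lambda> k (proj (\<psi> k)) $$ (i, j))"
    unfolding entry_sum_def mat_sum_def
    using c[THEN carrier_matD(1)] c[THEN carrier_matD(2)] by simp
  also have "\<dots> = (\<Sum>k<N. \<Sum>i<m. \<Sum>j<m. of_real (p k) * \<Lambda> k (proj (\<psi> k)) $$ (i, j))"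
    by (rule sum_swap3)
  also have "\<dots> = (\<Sum>k<N. of_real (p k) * entry_sum m (\<Lambda> k (outer d (\<lambda>i. \<psi> k $ i))))"
    by (simp add: entry_sum_def sum_distrib_left proj_eq_outer[OF assms(2)])
  finally show ?thesis
    by (subst hs_inner_max_coherent) (auto simp: mat_sum_def)
qed

text \<open>The lower-bound half of the infimum, for index functions instead of vectors; the set is
  bounded below by 0. The next lemma is the other half.\<close>

lemma distillation_norm_le:
  assumes "v \<in> carrier_vec d"
  shows "distillation_norm m v \<le> (\<Sum>i<d. cmod (v $ i - x i)) + sqrt m * sqrt (\<Sum>i<d. (cmod (x i))\<^sup>2)"
proof -
  have "distillation_norm m v \<le> l1_norm (v - vec d x) + sqrt (real m) * l2_norm (vec d x)"
    unfolding distillation_norm_def using assms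
    by (intro cINF_lower bdd_belowI[of _ 0]) (auto simp: l1_norm_def l2_norm_def sum_nonneg)
  then show ?thesis using assms by (simp add: l1_norm_def l2_norm_def)
qed

lemma distillation_norm_greatest:
  assumes "v \<in> carrier_vec d"
    and "\<And>x. C \<le> (\<Sum>i<d. cmod (v $ i - x i)) + sqrt m * sqrt (\<Sum>i<d. (cmod (x i))\<^sup>2)"
  shows "C \<le> distillation_norm m v"
  unfolding distillation_norm_def
proof (rule cINF_greatest)
  fix x :: "complex vec"
  assume "x \<in> carrier_vec (dim_vec v)"
  then show "C \<le> l1_norm (v - x) + sqrt (real m) * l2_norm x"
    using assms(1) assms(2)[of "\<lambda>i. x $ i"] by (simp add: l1_norm_def l2_norm_def)
qed (use zero_carrier_vec in blast)

text \<open>Each channel supplies a form that is positive by complete positivity, is bounded by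
  \<open>m\<close> by trace preservation and has unit diagonal by MIO. The mixture estimate then
  holds for every \<open>x\<close>, and the infimum over \<open>x\<close> is the norm.\<close>

lemma assisted_fidelities_MIO_le:
  assumes \<O>: "\<O> d m \<subseteq> MIO d m" and \<rho>: "density_op d \<rho>" and m: "1 \<le> m"
    and F: "F \<in> assisted_fidelities \<O> d m \<rho>"
  shows "F \<le> 1 / real m * (distillation_norm m (sqrt_diag \<rho>))\<^sup>2"
proof -
  obtain N p \<psi> \<Lambda> where dec: "pure_decomposition d \<rho> N p \<psi>" and \<Lambda>: "\<And>k. k < N \<Longrightarrow> \<Lambda> k \<in> MIO d m"
    and F: "F = Re (hs_inner (mat_sum m m (\<lambda>k. complex_of_real (p k) \<cdot>\<^sub>m \<Lambda> k (proj (\<psi> k))) {..<N}) (proj (max_coherent m)))"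
    using F \<O> unfolding assisted_fidelities_def by blast
  have p: "0 \<le> p k" and \<psi>: "\<psi> k \<in> carrier_vec d" if "k < N" for k
    using dec that by (auto simp: pure_decomposition_def unit_ket_def)
  have \<rho>_c: "\<rho> \<in> carrier_mat d d" using \<rho> by (auto simp: density_op_def psd_def)
  have ch: "channel d m (\<Lambda> k)" if "k < N" for k using \<Lambda>[OF that] by (simp add: MIO_def)
  define G where "G k i j = entry_sum m (\<Lambda> k (mat_unit d j i))" for k i j
  have q: "qform d (G k) u = entry_sum m (\<Lambda> k (outer d u))" if "k < N" for k u
    using channel_entry_sum[OF ch[OF that]] by (simp add: G_def[abs_def])
  have psd: "psd m (\<Lambda> k (outer d u))" if "k < N" for k u
    using channel_psd[OF ch[OF that] psd_outer] .
  have "mtrace (\<Lambda> k (outer d u)) = of_real (\<Sum>i<d. (cmod (u i))\<^sup>2)" if "k < N" for k u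
    using ch[OF that] by (simp add: channel_def mtrace_outer del: of_real_sum)
  then have bound: "Re (qform d (G k) u) \<le> real m * (\<Sum>i<d. (cmod (u i))\<^sup>2)" if "k < N" for k u
    using psd_entry_sum(2)[OF psd[OF that, of u]] that by (simp add: q)
  define \<delta> where "\<delta> i = sqrt (Re (\<rho> $$ (i, i)))" for i
  \<comment> \<open>The only trace of the decomposition that the estimate sees: squared moduli
    average to the diagonal of \<open>\<rho>\<close>.\<close>
  have diag: "Re (\<rho> $$ (i, i)) = (\<Sum>k<N. p k * (cmod (\<psi> k $ i))\<^sup>2)" if "i < d" for i
  proof -
    have "\<rho> = mat_sum d d (\<lambda>k. complex_of_real (p k) \<cdot>\<^sub>m proj (\<psi> k)) {..<N}"
      using dec by (simp add: pure_decomposition_def)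
    then have "\<rho> $$ (i, i) = (\<Sum>k<N. (complex_of_real (p k) \<cdot>\<^sub>m proj (\<psi> k)) $$ (i, i))"
      using that by (simp add: mat_sum_def)
    also have "\<dots> = (\<Sum>k<N. of_real (p k) * (\<psi> k $ i * cnj (\<psi> k $ i)))"
      using that \<psi> by (intro sum.cong) (auto simp: proj_eq_outer[of _ d] outer_def)
    also have "\<dots> = of_real (\<Sum>k<N. p k * (cmod (\<psi> k $ i))\<^sup>2)"
      by (simp only: complex_norm_square[symmetric] of_real_sum of_real_mult)
    finally show ?thesis by simp
  qed
  have \<delta>: "0 \<le> \<delta> i" "(\<delta> i)\<^sup>2 = (\<Sum>k<N. p k * (cmod (\<psi> k $ i))\<^sup>2)" if "i < d" for i
    using diag[OF that] p by (auto simp: \<delta>_def intro!: sum_nonneg)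
  define T where "T = (\<Sum>k<N. p k * Re (qform d (G k) (\<lambda>i. \<psi> k $ i)))"
  have F_T: "F = T / m"
    unfolding F T_def by (subst fidelity_value[where d = d]) (auto simp: ch \<psi> q)
  have T0: "0 \<le> T"
    unfolding T_def using p psd_entry_sum(1)[OF psd]
    by (intro sum_nonneg mult_nonneg_nonneg) (auto simp: q less_eq_complex_def)
  have sd: "sqrt_diag \<rho> \<in> carrier_vec d" "\<And>i. i < d \<Longrightarrow> sqrt_diag \<rho> $ i = of_real (\<delta> i)"
    using \<rho>_c by (auto simp: sqrt_diag_def \<delta>_def)
  have "sqrt T \<le> distillation_norm m (sqrt_diag \<rho>)"
  proof (rule distillation_norm_greatest[OF sd(1)])
    fix x :: "nat \<Rightarrow> complex"
    have "sqrt T \<le> (\<Sum>i<d. cmod (\<delta> i - x i)) + sqrt m * sqrt (\<Sum>i<d. (cmod (x i))\<^sup>2)"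
      unfolding T_def
    proof (rule sqrt_mixture_le)
      show "psdf d (G k)" if "k < N" for k
        unfolding psdf_def q[OF that] using psd_entry_sum(1)[OF psd[OF that]] by blast
      show "G k i i = 1" if "k < N" "i < d" for k i
        using MIO_entry_sum_diag[OF \<Lambda>[OF that(1)] that(2)] by (simp add: G_def)
    qed (use p bound \<delta> in auto)
    then show "sqrt T \<le> (\<Sum>i<d. cmod (sqrt_diag \<rho> $ i - x i)) + sqrt m * sqrt (\<Sum>i<d. (cmod (x i))\<^sup>2)"
      using sd(2) by simp
  qed
  then have "(sqrt T)\<^sup>2 \<le> (distillation_norm m (sqrt_diag \<rho>))\<^sup>2"
    using T0 by (intro power_mono) auto
  then show ?thesis using T0 m by (simp add: F_T divide_right_mono)
qed

section \<open>Attainment\<close>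

text \<open>\<open>k l a i\<close> is the entry in row \<open>a\<close> and column \<open>i\<close>
  of the \<open>l\<close>-th Kraus operator; with entries in place of matrix products, the proofs
  reduce to rearranging sums.\<close>

definition kraus_map :: "nat \<Rightarrow> nat \<Rightarrow> nat \<Rightarrow> (nat \<Rightarrow> nat \<Rightarrow> nat \<Rightarrow> complex) \<Rightarrow> complex mat \<Rightarrow> complex mat" where
  "kraus_map d m N k X = mat m m (\<lambda>(a, b). \<Sum>l<N. \<Sum>i<d. \<Sum>j<d. k l a i * X $$ (i, j) * cnj (k l b j))"

lemma kraus_map_carrier [simp]: "kraus_map d m N k X \<in> carrier_mat m m"
  by (simp add: kraus_map_def)

lemma kraus_decomposition_kraus_map:
  "kraus_decomposition d m (kraus_map d m N k) N (\<lambda>l. mat m d (\<lambda>(a, i). k l a i))"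
  unfolding kraus_decomposition_def
proof (intro conjI ballI allI impI)
  fix X :: "complex mat" assume X: "X \<in> carrier_mat d d"
  have "(mat m d (\<lambda>(a, i). k l a i) * X * mat_adjoint (mat m d (\<lambda>(a, i). k l a i))) $$ (a, b)
     = (\<Sum>i<d. \<Sum>j<d. k l a i * X $$ (i, j) * cnj (k l b j))" if "a < m" "b < m" for l a b
  proof -
    have "(mat m d (\<lambda>(a, i). k l a i) * X * mat_adjoint (mat m d (\<lambda>(a, i). k l a i))) $$ (a, b)
        = (\<Sum>j<d. (\<Sum>i<d. k l a i * X $$ (i, j)) * cnj (k l b j))"
      using that X by (simp add: scalar_prod_def lessThan_atLeast0)
    also have "\<dots> = (\<Sum>j<d. \<Sum>i<d. k l a i * X $$ (i, j) * cnj (k l b j))"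
      by (simp add: sum_distrib_right)
    finally show ?thesis by (subst sum.swap) simp
  qed
  then show "kraus_map d m N k X
    = mat_sum m m (\<lambda>l. mat m d (\<lambda>(a, i). k l a i) * X * mat_adjoint (mat m d (\<lambda>(a, i). k l a i))) {..<N}"
    by (intro eq_matI) (auto simp: kraus_map_def mat_sum_def)
qed simp

lemma linear_map_kraus_map: "linear_map d m (kraus_map d m N k)"
  unfolding linear_map_def
proof (intro conjI ballI allI)
  show "kraus_map d m N k (X + Y) = kraus_map d m N k X + kraus_map d m N k Y"
    if "X \<in> carrier_mat d d" "Y \<in> carrier_mat d d" for X Y
    using that by (intro eq_matI) (auto simp: kraus_map_def algebra_simps sum.distrib)
  show "kraus_map d m N k (c \<cdot>\<^sub>m X) = c \<cdot>\<^sub>m kraus_map d m N k X"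
    if "X \<in> carrier_mat d d" for X c
    using that by (intro eq_matI) (auto simp: kraus_map_def sum_distrib_left mult_ac)
qed simp

lemma qform_sum: "qform d (\<lambda>i j. \<Sum>l<N. A l i j) w = (\<Sum>l<N. qform d (A l) w)"
proof -
  have "qform d (\<lambda>i j. \<Sum>l<N. A l i j) w = (\<Sum>i<d. \<Sum>j<d. \<Sum>l<N. cnj (w i) * A l i j * w j)"
    by (simp add: qform_def sum_distrib_left sum_distrib_right)
  also have "\<dots> = (\<Sum>l<N. qform d (A l) w)"
    unfolding qform_def by (rule sum_swap3)
  finally show ?thesis .
qed

text \<open>Bookkeeping for complete positivity: the output indices move inside, the input indices
  outside.\<close>

lemma sum_interchange_pairs:
  "(\<Sum>b\<in>B. \<Sum>a\<in>A. \<Sum>b'\<in>B. \<Sum>a'\<in>A. \<Sum>i\<in>I. \<Sum>j\<in>I. T b a b' a' i j)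
    = (\<Sum>b\<in>B. \<Sum>i\<in>I. \<Sum>b'\<in>B. \<Sum>j\<in>I. \<Sum>a\<in>A. \<Sum>a'\<in>A. T b a b' a' i j)"
proof (rule sum.cong[OF refl])
  fix b
  have "(\<Sum>a\<in>A. \<Sum>b'\<in>B. \<Sum>a'\<in>A. \<Sum>i\<in>I. \<Sum>j\<in>I. T b a b' a' i j)
      = (\<Sum>a\<in>A. \<Sum>i\<in>I. \<Sum>b'\<in>B. \<Sum>a'\<in>A. \<Sum>j\<in>I. T b a b' a' i j)"
    by (rule sum.cong[OF refl]) (rule sum_swap3)
  also have "\<dots> = (\<Sum>i\<in>I. \<Sum>a\<in>A. \<Sum>b'\<in>B. \<Sum>a'\<in>A. \<Sum>j\<in>I. T b a b' a' i j)"
    by (rule sum.swap)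
  also have "\<dots> = (\<Sum>i\<in>I. \<Sum>a\<in>A. \<Sum>b'\<in>B. \<Sum>j\<in>I. \<Sum>a'\<in>A. T b a b' a' i j)"
    by (rule sum.cong[OF refl], rule sum.cong[OF refl], rule sum.cong[OF refl]) (rule sum.swap)
  also have "\<dots> = (\<Sum>i\<in>I. \<Sum>b'\<in>B. \<Sum>j\<in>I. \<Sum>a\<in>A. \<Sum>a'\<in>A. T b a b' a' i j)"
    by (rule sum.cong[OF refl]) (rule sum_swap3[symmetric])
  finally show "(\<Sum>a\<in>A. \<Sum>b'\<in>B. \<Sum>a'\<in>A. \<Sum>i\<in>I. \<Sum>j\<in>I. T b a b' a' i j)
      = (\<Sum>i\<in>I. \<Sum>b'\<in>B. \<Sum>j\<in>I. \<Sum>a\<in>A. \<Sum>a'\<in>A. T b a b' a' i j)" .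
qed

text \<open>Each Kraus operator acts on the composite space by a congruence, so its contribution at
  \<open>w\<close> is the form of \<open>X\<close> at the transformed vector.\<close>

lemma completely_positive_kraus_map: "completely_positive d m (kraus_map d m N k)"
  unfolding completely_positive_def
proof (intro allI impI)
  fix n X assume X: "psd (n * d) X"
  define B where "B l r c = (\<Sum>i<d. \<Sum>j<d. k l (r mod m) i * X $$ (r div m * d + i, c div m * d + j) * cnj (k l (c mod m) j))"
    for l r c
  \<comment> \<open>The image of \<open>w\<close> under the identity tensored with the adjoint of
    the \<open>l\<close>-th Kraus operator.\<close>
  define g where "g l w s = (\<Sum>a<m. cnj (k l a (s mod d)) * w (s div d * m + a))" for l and w :: "nat \<Rightarrow> complex" and s
  have B: "qform (n * m) (B l) w = qform (n * d) (\<lambda>s t. X $$ (s, t)) (g l w)" for l w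
  proof -
    have "qform (n * m) (B l) w = (\<Sum>b<n. \<Sum>a<m. \<Sum>b'<n. \<Sum>a'<m. \<Sum>i<d. \<Sum>j<d.
        cnj (w (b * m + a)) * (k l a i * X $$ (b * d + i, b' * d + j) * cnj (k l a' j)) * w (b' * m + a'))"
      unfolding qform_def sum_lessThan_mult
      by (intro sum.cong refl) (simp add: B_def sum_distrib_left sum_distrib_right)
    also have "\<dots> = (\<Sum>b<n. \<Sum>i<d. \<Sum>b'<n. \<Sum>j<d. \<Sum>a<m. \<Sum>a'<m.
        cnj (w (b * m + a)) * (k l a i * X $$ (b * d + i, b' * d + j) * cnj (k l a' j)) * w (b' * m + a'))"
      by (rule sum_interchange_pairs)
    also have "\<dots> = (\<Sum>b<n. \<Sum>i<d. \<Sum>b'<n. \<Sum>j<d.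
        cnj (g l w (b * d + i)) * X $$ (b * d + i, b' * d + j) * g l w (b' * d + j))"
    proof (intro sum.cong refl)
      fix b i b' j assume "i \<in> {..<d}" "j \<in> {..<d}"
      then have "cnj (g l w (b * d + i)) * X $$ (b * d + i, b' * d + j) * g l w (b' * d + j)
          = X $$ (b * d + i, b' * d + j) *
            ((\<Sum>a<m. k l a i * cnj (w (b * m + a))) * (\<Sum>a'<m. cnj (k l a' j) * w (b' * m + a')))"
        by (simp add: g_def)
      also have "\<dots> = (\<Sum>a<m. \<Sum>a'<m.
          cnj (w (b * m + a)) * (k l a i * X $$ (b * d + i, b' * d + j) * cnj (k l a' j)) * w (b' * m + a'))"
        unfolding sum_product unfolding sum_distrib_left by (intro sum.cong refl) (simp add: mult_ac)
      finally show "(\<Sum>a<m. \<Sum>a'<m.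
          cnj (w (b * m + a)) * (k l a i * X $$ (b * d + i, b' * d + j) * cnj (k l a' j)) * w (b' * m + a'))
          = cnj (g l w (b * d + i)) * X $$ (b * d + i, b' * d + j) * g l w (b' * d + j)" ..
    qed
    also have "\<dots> = qform (n * d) (\<lambda>s t. X $$ (s, t)) (g l w)"
      unfolding qform_def sum_lessThan_mult ..
    finally show ?thesis .
  qed
  have "0 \<le> qform (n * m) (\<lambda>r c. ampliation n d m (kraus_map d m N k) X $$ (r, c)) w" for w
  proof -
    have "qform (n * m) (\<lambda>r c. ampliation n d m (kraus_map d m N k) X $$ (r, c)) w
        = qform (n * m) (\<lambda>r c. \<Sum>l<N. B l r c) w"
      unfolding qform_def
    proof (intro sum.cong refl)
      fix r c assume rc: "r \<in> {..<n * m}" "c \<in> {..<n * m}"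
      then have "0 < m" by (auto intro: gr0I)
      then show "cnj (w r) * ampliation n d m (kraus_map d m N k) X $$ (r, c) * w c = cnj (w r) * (\<Sum>l<N. B l r c) * w c"
        using rc by (simp add: ampliation_def kraus_map_def B_def)
    qed
    also have "\<dots> = (\<Sum>l<N. qform (n * d) (\<lambda>s t. X $$ (s, t)) (g l w))"
      by (simp add: qform_sum B)
    finally show ?thesis
      using X unfolding psd_iff_psdf psdf_def by (simp add: sum_nonneg)
  qed
  then show "psd (n * m) (ampliation n d m (kraus_map d m N k) X)"
    unfolding psd_iff_psdf psdf_def by (simp add: ampliation_def)
qed

text \<open>The hypothesis is the completeness relation for the Kraus operators in entries; after
  reordering the sums it leaves only the diagonal of \<open>X\<close>.\<close>

lemma channel_kraus_map:
  assumes "\<And>i j. i < d \<Longrightarrow> j < d \<Longrightarrow> (\<Sum>l<N. \<Sum>a<m. k l a i * cnj (k l a j)) = (if i = j then 1 else 0)"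
  shows "channel d m (kraus_map d m N k)"
  unfolding channel_def
proof (intro conjI ballI linear_map_kraus_map completely_positive_kraus_map)
  fix X :: "complex mat" assume X: "X \<in> carrier_mat d d"
  have "mtrace (kraus_map d m N k X) = (\<Sum>a<m. \<Sum>l<N. \<Sum>i<d. \<Sum>j<d. X $$ (i, j) * (k l a i * cnj (k l a j)))"
    by (simp add: mtrace_def kraus_map_def mult_ac)
  also have "\<dots> = (\<Sum>l<N. \<Sum>a<m. \<Sum>i<d. \<Sum>j<d. X $$ (i, j) * (k l a i * cnj (k l a j)))"
    by (rule sum.swap)
  also have "\<dots> = (\<Sum>l<N. \<Sum>i<d. \<Sum>j<d. \<Sum>a<m. X $$ (i, j) * (k l a i * cnj (k l a j)))"
    by (rule sum.cong[OF refl], rule sum_swap3[symmetric])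
  also have "\<dots> = (\<Sum>i<d. \<Sum>j<d. \<Sum>l<N. \<Sum>a<m. X $$ (i, j) * (k l a i * cnj (k l a j)))"
    by (rule sum_swap3[symmetric])
  also have "\<dots> = (\<Sum>i<d. \<Sum>j<d. if i = j then X $$ (i, j) else 0)"
    unfolding sum_distrib_left[symmetric] using assms by (intro sum.cong) auto
  also have "\<dots> = mtrace X"
    using X by (simp add: mtrace_def)
  finally show "mtrace (kraus_map d m N k X) = mtrace X" .
qed

text \<open>The \<open>l\<close>-th operator maps basis vector \<open>i\<close> to
  \<open>c l i\<close> times basis vector \<open>f l i\<close>.\<close>

definition relabelling :: "(nat \<Rightarrow> nat \<Rightarrow> nat) \<Rightarrow> (nat \<Rightarrow> nat \<Rightarrow> complex) \<Rightarrow> nat \<Rightarrow> nat \<Rightarrow> nat \<Rightarrow> complex" where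
  "relabelling f c l a i = (if f l i = a then c l i else 0)"

text \<open>One nonzero entry at most per column makes the operators incoherent, one at most per row
  their adjoints; together they give commutation with dephasing. Column sums are the coefficients,
  which yields the overlap.\<close>

lemma relabelling_free:
  assumes f: "\<And>l i. l < N \<Longrightarrow> i < d \<Longrightarrow> c l i \<noteq> 0 \<Longrightarrow> f l i < m"
    and inj: "\<And>l. l < N \<Longrightarrow> inj_on (f l) {i. i < d \<and> c l i \<noteq> 0}"
    and unit: "\<And>i. i < d \<Longrightarrow> (\<Sum>l<N. (cmod (c l i))\<^sup>2) = 1"
  shows "kraus_map d m N (relabelling f c) \<in> SIO d m \<inter> DIO d m"
    and "entry_sum m (kraus_map d m N (relabelling f c) (outer d u)) = of_real (\<Sum>l<N. (cmod (\<Sum>i<d. c l i * u i))\<^sup>2)"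
proof -
  define k where "k = relabelling f c"
  have col: "k l a i * cnj (k l b i) = 0" if "a \<noteq> b" for l a b i
    using that by (auto simp: k_def relabelling_def)
  \<comment> \<open>Injectivity on the support keeps two columns from meeting in a row.\<close>
  have row: "k l a i * cnj (k l a j) = 0" if "i \<noteq> j" "l < N" "i < d" "j < d" for l a i j
    using that inj[OF that(2)] by (auto simp: k_def relabelling_def inj_on_def)
  have col_sum: "(\<Sum>a<m. k l a i) = c l i" if "l < N" "i < d" for l i
    using f[OF that] by (cases "c l i = 0") (auto simp: k_def relabelling_def)
  have ch: "channel d m (kraus_map d m N k)"
  proof (rule channel_kraus_map)
    fix i j assume ij: "i < d" "j < d"
    show "(\<Sum>l<N. \<Sum>a<m. k l a i * cnj (k l a j)) = (if i = j then 1 else 0)"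
    proof (cases "i = j")
      case True
      have "(\<Sum>a<m. k l a i * cnj (k l a i)) = of_real ((cmod (c l i))\<^sup>2)" if "l < N" for l
      proof -
        have "(\<Sum>a<m. k l a i * cnj (k l a i)) = (\<Sum>a<m. if f l i = a then c l i * cnj (c l i) else 0)"
          by (intro sum.cong) (auto simp: k_def relabelling_def)
        also have "\<dots> = c l i * cnj (c l i)"
          using f[OF that ij(1)] by (cases "c l i = 0") auto
        finally show ?thesis by (simp only: complex_norm_square)
      qed
      then have "(\<Sum>l<N. \<Sum>a<m. k l a i * cnj (k l a i)) = of_real (\<Sum>l<N. (cmod (c l i))\<^sup>2)"
        by simp
      then show ?thesis using True by (simp add: unit[OF ij(2)] del: of_real_sum)
    qed (use row ij in auto)
  qed
  define K where "K l = mat m d (\<lambda>(a, i). k l a i)" for l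
  have K: "incoherent_op (K l)" "incoherent_op (mat_adjoint (K l))" if "l < N" for l
  proof -
    show "incoherent_op (K l)"
      unfolding incoherent_op_def diagonal_mat_def
    proof (intro allI impI)
      fix \<sigma> a b
      assume s: "incoherent_state (dim_col (K l)) \<sigma>" and a: "a < dim_row (K l * \<sigma> * mat_adjoint (K l))"
        and b: "b < dim_col (K l * \<sigma> * mat_adjoint (K l))" and ab: "a \<noteq> b"
      have \<sigma>: "\<sigma> \<in> carrier_mat d d" "\<sigma> = dephase \<sigma>"
        using s by (auto simp: K_def incoherent_state_def density_op_def psd_def)
      have off: "\<sigma> $$ (i, j) = 0" if "i < d" "j < d" "i \<noteq> j" for i j
        using that \<sigma>(1) by (subst \<sigma>(2)) (auto simp: dephase_def)
      have "(K l * \<sigma> * mat_adjoint (K l)) $$ (a, b) = (\<Sum>j<d. (\<Sum>i<d. k l a i * \<sigma> $$ (i, j)) * cnj (k l b j))"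
        using a b \<sigma>(1) by (simp add: K_def scalar_prod_def lessThan_atLeast0)
      also have "\<dots> = (\<Sum>j<d. \<Sum>i<d. \<sigma> $$ (i, j) * (k l a i * cnj (k l b j)))"
        unfolding sum_distrib_right by (simp add: mult_ac)
      also have "\<dots> = 0"
      proof (intro sum.neutral ballI)
        fix j i assume "j \<in> {..<d}" "i \<in> {..<d}"
        then show "\<sigma> $$ (i, j) * (k l a i * cnj (k l b j)) = 0"
          using off[of i j] col[OF ab, of l j] by (cases "i = j") auto
      qed
      finally show "(K l * \<sigma> * mat_adjoint (K l)) $$ (a, b) = 0" .
    qed
    show "incoherent_op (mat_adjoint (K l))"
      unfolding incoherent_op_def diagonal_mat_def
    proof (intro allI impI)
      fix \<sigma> i j
      assume s: "incoherent_state (dim_col (mat_adjoint (K l))) \<sigma>"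
        and i: "i < dim_row (mat_adjoint (K l) * \<sigma> * mat_adjoint (mat_adjoint (K l)))"
        and j: "j < dim_col (mat_adjoint (K l) * \<sigma> * mat_adjoint (mat_adjoint (K l)))" and ij: "i \<noteq> j"
      have \<sigma>: "\<sigma> \<in> carrier_mat m m" "\<sigma> = dephase \<sigma>"
        using s by (auto simp: K_def incoherent_state_def density_op_def psd_def)
      have off: "\<sigma> $$ (a, b) = 0" if "a < m" "b < m" "a \<noteq> b" for a b
        using that \<sigma>(1) by (subst \<sigma>(2)) (auto simp: dephase_def)
      have "(mat_adjoint (K l) * \<sigma> * mat_adjoint (mat_adjoint (K l))) $$ (i, j)
          = (\<Sum>b<m. (\<Sum>a<m. cnj (k l a i) * \<sigma> $$ (a, b)) * k l b j)"
        using i j \<sigma>(1) by (simp add: K_def scalar_prod_def lessThan_atLeast0)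
      also have "\<dots> = (\<Sum>b<m. \<Sum>a<m. \<sigma> $$ (a, b) * cnj (k l a i * cnj (k l b j)))"
        unfolding sum_distrib_right by (simp add: mult_ac)
      also have "\<dots> = 0"
      proof (intro sum.neutral ballI)
        fix b a assume "b \<in> {..<m}" "a \<in> {..<m}"
        moreover have "i < d" "j < d" using i j by (auto simp: K_def)
        ultimately show "\<sigma> $$ (a, b) * cnj (k l a i * cnj (k l b j)) = 0"
          using off[of a b] row[OF ij that, of a] by (cases "a = b") auto
      qed
      finally show "(mat_adjoint (K l) * \<sigma> * mat_adjoint (mat_adjoint (K l))) $$ (i, j) = 0" .
    qed
  qed
  have "kraus_map d m N k \<in> SIO d m"
    unfolding SIO_def using ch kraus_decomposition_kraus_map[of d m N k, folded K_def] K by blast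
  \<comment> \<open>By \<open>row\<close>, only the diagonal of \<open>X\<close> reaches the
    diagonal of the output; by \<open>col\<close>, it reaches nothing else.\<close>
  moreover have "kraus_map d m N k \<in> DIO d m"
    unfolding DIO_def
  proof (intro CollectI conjI ch ballI eq_matI)
    fix X a b
    assume X: "X \<in> carrier_mat d d"
      and "a < dim_row (kraus_map d m N k (dephase X))" "b < dim_col (kraus_map d m N k (dephase X))"
    then have ab: "a < m" "b < m" by (auto simp: kraus_map_def)
    have "kraus_map d m N k (dephase X) $$ (a, b)
      = (\<Sum>l<N. \<Sum>i<d. \<Sum>j<d. k l a i * dephase X $$ (i, j) * cnj (k l b j))"
      using ab by (simp add: kraus_map_def)
    also have "\<dots> = (\<Sum>l<N. \<Sum>i<d. \<Sum>j<d. if i = j then X $$ (i, j) * (k l a i * cnj (k l b j)) else 0)"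
      by (intro sum.cong refl) (use X in \<open>auto simp: dephase_def\<close>)
    also have "\<dots> = (if a = b then \<Sum>l<N. \<Sum>i<d. \<Sum>j<d. X $$ (i, j) * (k l a i * cnj (k l b j)) else 0)"
    proof (cases "a = b")
      case True
      have "(\<Sum>l<N. \<Sum>i<d. \<Sum>j<d. if i = j then X $$ (i, j) * (k l b i * cnj (k l b j)) else 0)
          = (\<Sum>l<N. \<Sum>i<d. \<Sum>j<d. X $$ (i, j) * (k l b i * cnj (k l b j)))"
        by (intro sum.cong refl) (use row in auto)
      then show ?thesis using True by simp
    next
      case False
      then show ?thesis using col[OF False] by simp
    qed
    also have "\<dots> = dephase (kraus_map d m N k X) $$ (a, b)"
      using ab by (simp add: kraus_map_def dephase_def mult_ac)
    finally show "dephase (kraus_map d m N k X) $$ (a, b) = kraus_map d m N k (dephase X) $$ (a, b)" ..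
  qed (auto simp: kraus_map_def dephase_def)
  ultimately show "kraus_map d m N (relabelling f c) \<in> SIO d m \<inter> DIO d m"
    by (simp add: k_def)
  have "entry_sum m (kraus_map d m N k (outer d u))
      = (\<Sum>a<m. \<Sum>b<m. \<Sum>l<N. (\<Sum>i<d. k l a i * u i) * cnj (\<Sum>j<d. k l b j * u j))"
    by (simp add: entry_sum_def kraus_map_def outer_def sum_product mult_ac)
  also have "\<dots> = (\<Sum>l<N. \<Sum>a<m. \<Sum>b<m. (\<Sum>i<d. k l a i * u i) * cnj (\<Sum>j<d. k l b j * u j))"
    by (rule sum_swap3)
  also have "\<dots> = (\<Sum>l<N. (\<Sum>a<m. \<Sum>i<d. k l a i * u i) * cnj (\<Sum>b<m. \<Sum>j<d. k l b j * u j))"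
    by (simp only: sum_product cnj_sum)
  also have "\<dots> = (\<Sum>l<N. (\<Sum>i<d. c l i * u i) * cnj (\<Sum>i<d. c l i * u i))"
  proof (intro sum.cong refl)
    fix l assume "l \<in> {..<N}"
    then have "(\<Sum>a<m. \<Sum>i<d. k l a i * u i) = (\<Sum>i<d. c l i * u i)"
      by (subst sum.swap) (simp add: sum_distrib_right[symmetric] col_sum)
    then show "(\<Sum>a<m. \<Sum>i<d. k l a i * u i) * cnj (\<Sum>b<m. \<Sum>j<d. k l b j * u j)
      = (\<Sum>i<d. c l i * u i) * cnj (\<Sum>i<d. c l i * u i)" by simp
  qed
  also have "\<dots> = of_real (\<Sum>l<N. (cmod (\<Sum>i<d. c l i * u i))\<^sup>2)"
    by (simp only: complex_norm_square[symmetric] of_real_sum)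
  finally show "entry_sum m (kraus_map d m N (relabelling f c) (outer d u)) = of_real (\<Sum>l<N. (cmod (\<Sum>i<d. c l i * u i))\<^sup>2)"
    by (simp add: k_def)
qed

text \<open>Subsets index the Kraus operators: each relabels its subset injectively by output labels
  after the phases of \<open>u\<close> are removed. The value attained belongs to one particular
  \<open>x\<close> and so dominates the infimum.\<close>

lemma ex_optimal_operation:
  fixes u :: "nat \<Rightarrow> complex"
  assumes m: "1 \<le> m"
  obtains \<Lambda> where "\<Lambda> \<in> SIO d m \<inter> DIO d m"
    and "(distillation_norm m (vec d (\<lambda>i. of_real (cmod (u i)))))\<^sup>2 \<le> Re (entry_sum m (\<Lambda> (outer d u)))"
proof -
  obtain c :: "nat set \<Rightarrow> nat \<Rightarrow> real" and x where c: "\<And>S i. c S i \<noteq> 0 \<Longrightarrow> i \<in> S \<and> card S \<le> m"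
    and unit: "\<And>i. i < d \<Longrightarrow> (\<Sum>S\<in>Pow {..<d}. (c S i)\<^sup>2) = 1"
    and val: "(\<Sum>S\<in>Pow {..<d}. (\<Sum>i<d. c S i * cmod (u i))\<^sup>2)
      = ((\<Sum>i<d. \<bar>cmod (u i) - x i\<bar>) + sqrt m * sqrt (\<Sum>i<d. (x i)\<^sup>2))\<^sup>2"
    using ex_optimal_coefficients[of d "\<lambda>i. cmod (u i)" m] m by auto
  define N where "N = card (Pow {..<d})"
  obtain h where h: "bij_betw h {..<N} (Pow {..<d})"
    using ex_bij_betw_nat_finite[of "Pow {..<d}"] by (auto simp: N_def lessThan_atLeast0)
  have reindex: "(\<Sum>l<N. g (h l)) = (\<Sum>S\<in>Pow {..<d}. g S)" for g :: "nat set \<Rightarrow> real"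
    by (rule sum.reindex_bij_betw[OF h])
  have "\<exists>f. inj_on f S \<and> f ` S \<subseteq> {..<m}" if "S \<subseteq> {..<d}" "card S \<le> m" for S :: "nat set"
    using that card_le_inj[of S "{..<m}"] finite_subset[OF that(1)] by auto
  then obtain e where e: "\<And>S. S \<subseteq> {..<d} \<Longrightarrow> card S \<le> m \<Longrightarrow> inj_on (e S) S \<and> e S ` S \<subseteq> {..<m}"
    by metis
  \<comment> \<open>Phases turning \<open>u\<close> into its moduli; the default 1 keeps them of
    modulus one where \<open>u i = 0\<close>.\<close>
  define \<omega> where "\<omega> i = (if u i = 0 then 1 else cnj (u i) / of_real (cmod (u i)))" for i
  have "cnj (u i) * u i = of_real (cmod (u i)) * of_real (cmod (u i))" for i
    using complex_norm_square[of "u i"] by (simp add: power2_eq_square mult.commute)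
  then have \<omega>: "cmod (\<omega> i) = 1" "\<omega> i * u i = of_real (cmod (u i))" for i
    by (auto simp: \<omega>_def norm_divide)
  define c' where "c' l i = of_real (c (h l) i) * \<omega> i" for l i
  define \<Lambda> where "\<Lambda> = kraus_map d m N (relabelling (\<lambda>l. e (h l)) c')"
  have hS: "h l \<subseteq> {..<d}" if "l < N" for l
    using h that by (auto simp: bij_betw_def)
  have supp: "i \<in> h l \<and> card (h l) \<le> m" if "c' l i \<noteq> 0" for l i
    using that c by (auto simp: c'_def)
  have 1: "e (h l) i < m" if "l < N" "i < d" "c' l i \<noteq> 0" for l i
    using e[OF hS[OF that(1)]] supp[OF that(3)] by blast
  have 2: "inj_on (e (h l)) {i. i < d \<and> c' l i \<noteq> 0}" if "l < N" for l
  proof (cases "card (h l) \<le> m")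
    case True
    then show ?thesis using e[OF hS[OF that]] supp by (blast intro: inj_on_subset)
  next
    case False
    \<comment> \<open>Subsets with more than \<open>m\<close> elements carry the zero
      operator.\<close>
    then have "{i. i < d \<and> c' l i \<noteq> 0} = {}" using supp by blast
    then show ?thesis by (simp only: inj_on_empty)
  qed
  have 3: "(\<Sum>l<N. (cmod (c' l i))\<^sup>2) = 1" if "i < d" for i
    using reindex[of "\<lambda>S. (c S i)\<^sup>2"] unit[OF that] by (simp add: c'_def norm_mult \<omega>)
  have mem: "\<Lambda> \<in> SIO d m \<inter> DIO d m"
    unfolding \<Lambda>_def using 1 2 3 by (rule relabelling_free(1))
  have "(\<Sum>i<d. c' l i * u i) = of_real (\<Sum>i<d. c (h l) i * cmod (u i))" for l
    by (simp add: c'_def \<omega> mult.assoc)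
  then have "(cmod (\<Sum>i<d. c' l i * u i))\<^sup>2 = (\<Sum>i<d. c (h l) i * cmod (u i))\<^sup>2" for l
    by (simp only: norm_of_real power2_abs)
  moreover have "entry_sum m (\<Lambda> (outer d u)) = of_real (\<Sum>l<N. (cmod (\<Sum>i<d. c' l i * u i))\<^sup>2)"
    unfolding \<Lambda>_def using 1 2 3 by (rule relabelling_free(2))
  ultimately have "Re (entry_sum m (\<Lambda> (outer d u))) = (\<Sum>S\<in>Pow {..<d}. (\<Sum>i<d. c S i * cmod (u i))\<^sup>2)"
    using reindex[of "\<lambda>S. (\<Sum>i<d. c S i * cmod (u i))\<^sup>2"] by simp
  then have value_eq: "Re (entry_sum m (\<Lambda> (outer d u)))
      = ((\<Sum>i<d. \<bar>cmod (u i) - x i\<bar>) + sqrt m * sqrt (\<Sum>i<d. (x i)\<^sup>2))\<^sup>2"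
    by (simp only: val)
  let ?v = "vec d (\<lambda>i. complex_of_real (cmod (u i)))"
  have "distillation_norm m ?v \<le> (\<Sum>i<d. cmod (?v $ i - of_real (x i))) + sqrt m * sqrt (\<Sum>i<d. (cmod (of_real (x i)))\<^sup>2)"
    by (rule distillation_norm_le) simp
  also have "\<dots> = (\<Sum>i<d. \<bar>cmod (u i) - x i\<bar>) + sqrt m * sqrt (\<Sum>i<d. (x i)\<^sup>2)"
    by (simp flip: of_real_diff)
  finally have le: "distillation_norm m ?v \<le> (\<Sum>i<d. \<bar>cmod (u i) - x i\<bar>) + sqrt m * sqrt (\<Sum>i<d. (x i)\<^sup>2)" .
  have "0 \<le> distillation_norm m ?v"
    by (rule distillation_norm_greatest[of _ d]) (auto intro!: add_nonneg_nonneg mult_nonneg_nonneg sum_nonneg)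
  then have "(distillation_norm m ?v)\<^sup>2 \<le> Re (entry_sum m (\<Lambda> (outer d u)))"
    unfolding value_eq using le by (intro power_mono)
  with mem show thesis by (rule that)
qed

text \<open>The factor vectors of \<open>\<rho>\<close> are normalised, their squared norms being
  the weights. This makes the supremum range over a nonempty set.\<close>

lemma ex_pure_decomposition:
  assumes "density_op d \<rho>"
  shows "\<exists>N p \<psi>. pure_decomposition d \<rho> N p \<psi>"
proof -
  have \<rho>: "\<rho> \<in> carrier_mat d d" "psdf d (\<lambda>i j. \<rho> $$ (i, j))" "mtrace \<rho> = 1"
    using assms by (auto simp: density_op_def psd_iff_psdf)
  obtain v where v: "\<And>i j. i < d \<Longrightarrow> j < d \<Longrightarrow> \<rho> $$ (i, j) = (\<Sum>k<d. v k i * cnj (v k j))"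
    using psdf_cholesky[OF \<rho>(2)] by blast
  define p where "p k = (\<Sum>i<d. (cmod (v k i))\<^sup>2)" for k
  have p0: "0 \<le> p k" for k by (simp add: p_def sum_nonneg)
  have sq: "of_real (sqrt (p k)) * of_real (sqrt (p k)) = (of_real (p k) :: complex)" for k
    using p0[of k] by (metis of_real_mult real_sqrt_mult_self abs_of_nonneg)
  \<comment> \<open>Components of weight \<open>0\<close> still have to be unit vectors; a basis
    vector exists because trace one excludes \<open>d = 0\<close>.\<close>
  define \<psi> where "\<psi> k = (if p k = 0 then unit_vec d 0 else vec d (\<lambda>i. v k i / of_real (sqrt (p k))))" for k
  have "d \<noteq> 0"
  proof
    assume "d = 0"
    then show False using \<rho>(1,3) by (simp add: mtrace_def)
  qed
  have unit: "unit_ket d (\<psi> k)" for k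
  proof (cases "p k = 0")
    case True
    have "unit_vec d 0 \<bullet>c unit_vec d 0 = (1 :: complex)"
      using \<open>d \<noteq> 0\<close> by (subst scalar_prod_left_unit) auto
    then show ?thesis using True \<open>d \<noteq> 0\<close> by (simp add: unit_ket_def \<psi>_def)
  next
    case False
    have "\<psi> k \<bullet>c \<psi> k = (\<Sum>i<d. (v k i * cnj (v k i)) / (of_real (sqrt (p k)) * of_real (sqrt (p k))))"
      using False by (simp add: \<psi>_def scalar_prod_def lessThan_atLeast0)
    also have "\<dots> = of_real (p k) / of_real (p k)"
      unfolding sq sum_divide_distrib[symmetric]
      by (simp only: p_def complex_norm_square of_real_sum)
    finally show ?thesis using False by (simp add: unit_ket_def \<psi>_def)
  qed
  have "of_real (p k) * (\<psi> k $ i * cnj (\<psi> k $ j)) = v k i * cnj (v k j)" if "i < d" "j < d" for k i j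
  proof (cases "p k = 0")
    case True
    then have "v k i = 0" using that by (auto simp: p_def sum_nonneg_eq_0_iff)
    then show ?thesis using True by simp
  next
    case False
    then show ?thesis using that sq[of k] by (simp add: \<psi>_def)
  qed
  then have "\<rho> = mat_sum d d (\<lambda>k. complex_of_real (p k) \<cdot>\<^sub>m proj (\<psi> k)) {..<d}"
    using \<rho>(1) unit
    by (intro eq_matI) (auto simp: mat_sum_def v unit_ket_def proj_eq_outer[of _ d] outer_def intro!: sum.cong)
  moreover have "(\<Sum>k<d. p k) = 1"
  proof -
    have "complex_of_real (\<Sum>k<d. p k) = (\<Sum>k<d. \<Sum>i<d. v k i * cnj (v k i))"
      by (simp add: p_def complex_norm_square del: of_real_power)
    also have "\<dots> = (\<Sum>i<d. \<Sum>k<d. v k i * cnj (v k i))" by (rule sum.swap)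
    also have "\<dots> = mtrace \<rho>" using \<rho>(1) v by (simp add: mtrace_def)
    finally show ?thesis using \<rho>(3) by (metis of_real_eq_1_iff)
  qed
  ultimately have "pure_decomposition d \<rho> d p \<psi>"
    using p0 unit by (simp add: pure_decomposition_def)
  then show ?thesis by blast
qed

lemma assisted_fidelitiesI:
  assumes "pure_decomposition d \<rho> N p \<psi>" and "\<forall>i<N. \<Lambda> i \<in> \<O> d m"
  shows "Re (hs_inner (mat_sum m m (\<lambda>i. complex_of_real (p i) \<cdot>\<^sub>m \<Lambda> i (proj (\<psi> i))) {..<N})
    (proj (max_coherent m))) \<in> assisted_fidelities \<O> d m \<rho>"
  unfolding assisted_fidelities_def
  by (rule CollectI, (rule exI)+, intro conjI, rule refl) (rule assms)+

lemma assisted_fidelities_nonempty: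
  assumes \<O>: "SIO d m \<inter> DIO d m \<subseteq> \<O> d m" and \<rho>: "density_op d \<rho>" and m: "1 \<le> m"
  shows "assisted_fidelities \<O> d m \<rho> \<noteq> {}"
proof -
  obtain \<Lambda> where "\<Lambda> \<in> SIO d m \<inter> DIO d m" using ex_optimal_operation[OF m] .
  then have "\<Lambda> \<in> \<O> d m" using \<O> by blast
  moreover obtain N p \<psi> where "pure_decomposition d \<rho> N p \<psi>"
    using ex_pure_decomposition[OF \<rho>] by blast
  ultimately show ?thesis
    using assisted_fidelitiesI[where \<Lambda> = "\<lambda>_. \<Lambda>"] by blast
qed

text \<open>The optimal operation for each component reaches the same value, since all components
  have the moduli \<open>sqrt_diag \<rho>\<close>; the weighted average reaches it too.\<close>

lemma flat_attains:
  assumes \<O>: "SIO d m \<inter> DIO d m \<subseteq> \<O> d m" and \<rho>: "density_op d \<rho>" and m: "1 \<le> m"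
    and flat: "flat_decomposable d (\<lambda>i j. \<rho> $$ (i, j))"
  shows "\<exists>F\<in>assisted_fidelities \<O> d m \<rho>. 1 / real m * (distillation_norm m (sqrt_diag \<rho>))\<^sup>2 \<le> F"
proof -
  have \<rho>_c: "\<rho> \<in> carrier_mat d d" "mtrace \<rho> = 1" using \<rho> by (auto simp: density_op_def psd_def)
  obtain N :: nat and p \<psi> where p: "\<And>k. k < N \<Longrightarrow> 0 \<le> p k" "(\<Sum>k<N. p k) = (1 :: real)"
    and \<psi>: "\<And>k i. k < N \<Longrightarrow> i < d \<Longrightarrow> (cmod (\<psi> k i))\<^sup>2 = Re (\<rho> $$ (i, i))"
    and dec: "\<And>i j. i < d \<Longrightarrow> j < d \<Longrightarrow> \<rho> $$ (i, j) = (\<Sum>k<N. of_real (p k) * (\<psi> k i * cnj (\<psi> k j)))"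
    using flat unfolding flat_decomposable_def by blast
  have unit: "unit_ket d (vec d (\<psi> k))" if "k < N" for k
  proof -
    have "vec d (\<psi> k) \<bullet>c vec d (\<psi> k) = (\<Sum>i<d. \<psi> k i * cnj (\<psi> k i))"
      by (simp add: scalar_prod_def lessThan_atLeast0)
    also have "\<dots> = of_real (\<Sum>i<d. (cmod (\<psi> k i))\<^sup>2)"
      by (simp only: complex_norm_square of_real_sum)
    also have "(\<Sum>i<d. (cmod (\<psi> k i))\<^sup>2) = Re (mtrace \<rho>)"
      using \<rho>_c(1) \<psi>[OF that] by (simp add: mtrace_def)
    finally show ?thesis using \<rho>_c(2) by (simp add: unit_ket_def)
  qed
  have "\<rho> = mat_sum d d (\<lambda>k. complex_of_real (p k) \<cdot>\<^sub>m proj (vec d (\<psi> k))) {..<N}"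
    using \<rho>_c(1) by (intro eq_matI) (auto simp: mat_sum_def dec proj_def)
  then have pd: "pure_decomposition d \<rho> N p (\<lambda>k. vec d (\<psi> k))"
    using p unit by (simp add: pure_decomposition_def)
  let ?D = "(distillation_norm m (sqrt_diag \<rho>))\<^sup>2"
  \<comment> \<open>Stated for all \<open>k\<close>, so that choice yields a total family of
    operations.\<close>
  have "\<exists>\<Lambda>. \<Lambda> \<in> SIO d m \<inter> DIO d m \<and> (k < N \<longrightarrow> ?D \<le> Re (entry_sum m (\<Lambda> (outer d (\<psi> k)))))" for k
  proof -
    obtain \<Lambda> where L: "\<Lambda> \<in> SIO d m \<inter> DIO d m"
      "(distillation_norm m (vec d (\<lambda>i. of_real (cmod (\<psi> k i)))))\<^sup>2 \<le> Re (entry_sum m (\<Lambda> (outer d (\<psi> k))))"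
      using ex_optimal_operation[OF m] .
    have "vec d (\<lambda>i. of_real (cmod (\<psi> k i))) = sqrt_diag \<rho>" if "k < N"
      using \<rho>_c(1) by (auto simp: sqrt_diag_def \<psi>[OF that, symmetric])
    then show ?thesis using L by auto
  qed
  then obtain \<Lambda> where \<Lambda>: "\<And>k. \<Lambda> k \<in> SIO d m \<inter> DIO d m"
    "\<And>k. k < N \<Longrightarrow> ?D \<le> Re (entry_sum m (\<Lambda> k (outer d (\<psi> k))))" by metis
  define F where "F = Re (hs_inner (mat_sum m m (\<lambda>k. complex_of_real (p k) \<cdot>\<^sub>m \<Lambda> k (proj (vec d (\<psi> k)))) {..<N}) (proj (max_coherent m)))"
  have "F \<in> assisted_fidelities \<O> d m \<rho>"
    unfolding F_def using pd \<Lambda>(1) \<O> by (intro assisted_fidelitiesI) auto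
  moreover have "1 / real m * ?D \<le> F"
  proof -
    have o: "outer d (\<lambda>i. vec d (\<psi> k) $ i) = outer d (\<psi> k)" for k by (auto simp: outer_def)
    have "F = (\<Sum>k<N. p k * Re (entry_sum m (\<Lambda> k (outer d (\<psi> k))))) / m"
      unfolding F_def using \<Lambda>(1) by (subst fidelity_value[where d = d]) (auto simp: DIO_def o)
    moreover have "?D \<le> (\<Sum>k<N. p k * Re (entry_sum m (\<Lambda> k (outer d (\<psi> k)))))"
    proof -
      have "?D = (\<Sum>k<N. p k * ?D)" using p(2) by (simp add: sum_distrib_right[symmetric])
      also have "\<dots> \<le> (\<Sum>k<N. p k * Re (entry_sum m (\<Lambda> k (outer d (\<psi> k)))))"
        using p(1) \<Lambda>(2) by (intro sum_mono mult_left_mono) auto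
      finally show ?thesis .
    qed
    ultimately show ?thesis using m by (simp add: divide_right_mono)
  qed
  ultimately show ?thesis by blast
qed

section \<open>Small dimensions, tensor powers and conclusion\<close>

lemma density_flat_decomposable:
  assumes "density_op k \<sigma>" "k \<le> 3"
  shows "flat_decomposable k (\<lambda>i j. \<sigma> $$ (i, j))"
proof (rule flat_decomposable_le3)
  have "\<sigma> \<in> carrier_mat k k" "mtrace \<sigma> = 1" using assms by (auto simp: density_op_def psd_def)
  then have "(\<Sum>i<k. \<sigma> $$ (i, i)) = 1" by (simp add: mtrace_def)
  then show "(\<Sum>i<k. Re (\<sigma> $$ (i, i))) = 1" by (simp flip: Re_sum)
qed (use assms in \<open>auto simp: density_op_def psd_iff_psdf\<close>)

lemma tensor_power_carrier:
  "\<sigma> \<in> carrier_mat k k \<Longrightarrow> tensor_power \<sigma> n \<in> carrier_mat (k ^ n) (k ^ n)"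
  by (induction n) (auto simp: kron_def)

lemma tensor_power_flat_decomposable:
  assumes \<sigma>: "density_op k \<sigma>" and k: "k \<le> 3"
  shows "flat_decomposable (k ^ n) (\<lambda>i j. tensor_power \<sigma> n $$ (i, j))"
proof (induction n)
  case 0
  show ?case
    unfolding flat_decomposable_def
    by (intro exI[of _ 1] exI[of _ "\<lambda>_. 1"] exI[of _ "\<lambda>_ _. 1"]) auto
next
  case (Suc n)
  have \<sigma>_c: "\<sigma> \<in> carrier_mat k k" "psdf k (\<lambda>i j. \<sigma> $$ (i, j))"
    using \<sigma> by (auto simp: density_op_def psd_iff_psdf)
  have "flat_decomposable (k * k ^ n) (\<lambda>i j. tensor_power \<sigma> (Suc n) $$ (i, j))"
  proof (rule flat_decomposable_kron[OF density_flat_decomposable[OF \<sigma> k] Suc])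
    show "tensor_power \<sigma> (Suc n) $$ (i, j)
        = \<sigma> $$ (i div k ^ n, j div k ^ n) * tensor_power \<sigma> n $$ (i mod k ^ n, j mod k ^ n)"
      if "i < k * k ^ n" "j < k * k ^ n" for i j
      using that \<sigma>_c(1) tensor_power_carrier[OF \<sigma>_c(1), of n] by (auto simp: kron_def)
    show "Im (\<sigma> $$ (i, i)) = 0" if "i < k" for i
      using psdf_diag[OF \<sigma>_c(2) that] by (simp add: less_eq_complex_def)
  qed
  then show ?case by simp
qed

theorem theorem6:
  fixes d m :: nat and \<rho> :: "complex mat" and \<O> :: op_class
  assumes "\<O> \<in> {MIO, DIO, IO, SIO}"
    and "density_op d \<rho>"
    and "m \<ge> 1"
  shows "assisted_fidelity \<O> d m \<rho> \<le> 1 / real m * (distillation_norm m (sqrt_diag \<rho>))\<^sup>2 \<and>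
    (d \<le> 3 \<or> (\<exists>n k \<sigma>. k \<le> 3 \<and> density_op k \<sigma> \<and> \<rho> = tensor_power \<sigma> n) \<longrightarrow>
      assisted_fidelity \<O> d m \<rho> = 1 / real m * (distillation_norm m (sqrt_diag \<rho>))\<^sup>2 \<and>
      assisted_fidelity \<O> d m \<rho> \<in> assisted_fidelities \<O> d m \<rho>)"
proof -
  let ?B = "1 / real m * (distillation_norm m (sqrt_diag \<rho>))\<^sup>2"
  let ?S = "assisted_fidelities \<O> d m \<rho>"
  \<comment> \<open>Every class lies between the intersection of SIO and DIO, where the optimal
    operations live, and MIO, where the bound holds.\<close>
  have sub: "\<O> d m \<subseteq> MIO d m" "SIO d m \<inter> DIO d m \<subseteq> \<O> d m"
    using assms(1) DIO_subset_MIO SIO_subset_IO IO_subset_MIO by blast+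
  have ub: "F \<le> ?B" if "F \<in> ?S" for F
    using assisted_fidelities_MIO_le[OF sub(1) assms(2,3) that] .
  have ne: "?S \<noteq> {}" by (rule assisted_fidelities_nonempty[where \<O> = \<O>, OF sub(2) assms(2,3)])
  have "assisted_fidelity \<O> d m \<rho> = ?B \<and> assisted_fidelity \<O> d m \<rho> \<in> ?S"
    if small: "d \<le> 3 \<or> (\<exists>n k \<sigma>. k \<le> 3 \<and> density_op k \<sigma> \<and> \<rho> = tensor_power \<sigma> n)"
  proof -
    have "flat_decomposable d (\<lambda>i j. \<rho> $$ (i, j))"
      using small
    proof
      assume "\<exists>n k \<sigma>. k \<le> 3 \<and> density_op k \<sigma> \<and> \<rho> = tensor_power \<sigma> n"
      then obtain n k \<sigma> where \<sigma>: "k \<le> 3" "density_op k \<sigma>" "\<rho> = tensor_power \<sigma> n" by blast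
      \<comment> \<open>The dimension is forced by the size of the matrix.\<close>
      have "d = k ^ n"
        using assms(2) \<sigma> tensor_power_carrier[of \<sigma> k n] by (auto simp: density_op_def psd_def)
      then show ?thesis using tensor_power_flat_decomposable[OF \<sigma>(2,1)] \<sigma>(3) by simp
    qed (rule density_flat_decomposable[OF assms(2)])
    then obtain F where "F \<in> ?S" "?B \<le> F"
      using flat_attains[where \<O> = \<O>, OF sub(2) assms(2,3)] by blast
    \<comment> \<open>The attained value also obeys the upper bound, so it equals \<open>?B\<close>,
      and the supremum is a maximum.\<close>
    then have "?B \<in> ?S" using ub[of F] by simp
    moreover from this have "Sup ?S = ?B" using ub by (intro cSup_eq_maximum)
    ultimately show ?thesis by (simp add: assisted_fidelity_def)
  qed
  moreover have "assisted_fidelity \<O> d m \<rho> \<le> ?B"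
    unfolding assisted_fidelity_def using ne ub by (rule cSup_least)
  ultimately show ?thesis by blast
qed

end
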